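(* Let $Z\in\mathbb R^{r\times r}$ be doubly nonnegative with positive diagonal, rank $d$, and rational kernel. For $k\in\mathbb Z_{>0}$, let $n=2kr$ and define $$W_{ij}=4(Z\otimes J_{2k})_{ij}\quad(i\ne j),\qquad W_{ii}=0.$$ For every $k\ge1$, the support graph of $W$ has no isolated vertices, the relaxation is exact, and $$Z^*=Z\otimes J_{2k},\qquad d(W)=d.$$ Moreover, for every $k\ge\kappa(Z)$, $$c(W)=n-d,$$ so the optimal cut sign vectors span the entire dual kernel $\ker Z^*$. The threshold $\kappa(Z)$ depends only on $\ker Z$. If the off-diagonal support of $Z$ (the graph on $\{1,\dots,r\}$ with edges $\{s,t\}$, $s\neq t$, $Z_{st}\ne0$) is connected, then the support graph of $W$ is connected for every $k\ge1$. The matrix $Z\otimes J_{2k}$ is completely positive if and only if $Z$ is. When these matrices are completely positive, their cp-ranks are equal.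
   Context: $J_m$ is the $m\times m$ all-ones matrix, $\otimes$ the Kronecker product. A subspace is rational if it has a basis of rational vectors (the zero subspace is rational). Doubly nonnegative means positive semidefinite and entrywise nonnegative. Completely positive means equal to $N^\top N$ with $N$ entrywise nonnegative; the cp-rank is the smallest number of rows of such an $N$. For a matrix $B$ with $r$ columns and rational kernel, $\kappa(B)=\min\{k\in\mathbb Z_{>0}: \operatorname{span}\{z\in\ker B\cap\mathbb Z^r:|z_t|\le k\ \forall t\}=\ker B\}$ (this minimum exists). For a symmetric nonnegative zero-diagonal $W\in\mathbb R^{n\times n}$, the support graph has edges $\{i,j\}$ with $W_{ij}>0$. Put $\operatorname{MC}(W)=\max_{x\in\{-1,1\}^n}\frac14\sum_{i\ne j}W_{ij}(1-x_ix_j)$ and $\operatorname{SDP}(W)=\max\{\frac14\sum_{i\ne j}W_{ij}(1-X_{ij}):X\succeq0,\ X_{ii}=1\ \forall i\}$. The relaxation (instance) is exact if $\operatorname{MC}(W)=\operatorname{SDP}(W)$. With $\delta_i=\sum_jW_{ij}$, $L_W=\operatorname{Diag}(\delta)-W$, the dual problem is $\min\{\mathbf 1^\top s:\operatorname{Diag}(s)-\frac14L_W\succeq0\}$; for an exact instance without isolated vertices its optimal solution $s^*$ is unique, and $Z^*=\operatorname{Diag}(s^* )-\frac14L_W$ is the optimal dual slack. $d(W)=\operatorname{rank}Z^*$, $\mathcal C(W)$ is the set of $x\in\{-1,1\}^n$ attaining $\operatorname{MC}(W)$ (optimal cut sign vectors), and $c(W)=\dim\operatorname{span}\mathcal C(W)$.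 *)

theory Defs
  imports
    "Jordan_Normal_Form.Matrix_Kernel"
    "Jordan_Normal_Form.DL_Rank"
    "Graph_Theory.Digraph_Component"
    "Graph_Theory.Pair_Digraph"
begin

text \<open>
  Matrices and vectors are those of \<^verbatim>\<open>Jordan_Normal_Form\<close>, indexed from 0; the size of a
  square matrix is read off from its number of rows.
\<close>

abbreviation vec_span :: "nat \<Rightarrow> real vec set \<Rightarrow> real vec set" where
  "vec_span n S \<equiv> LinearCombinations.module.span class_ring (module_vec TYPE(real) n) S"

abbreviation subspace_vs :: "nat \<Rightarrow> real vec set \<Rightarrow> (real, real vec) module" where
  "subspace_vs n U \<equiv> module_vec TYPE(real) n\<lparr>carrier := U\<rparr>"

abbreviation mat_rank :: "real mat \<Rightarrow> nat" where
  "mat_rank A \<equiv> vec_space.rank (dim_row A) A"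

definition rational_subspace :: "nat \<Rightarrow> real vec set \<Rightarrow> bool" where
  "rational_subspace n U \<longleftrightarrow>
     (\<exists>B. vectorspace.basis class_ring (subspace_vs n U) B \<and> (\<forall>v\<in>B. \<forall>i<n. v $ i \<in> \<rat>))"

definition kappa :: "real mat \<Rightarrow> nat" where
  "kappa B = (LEAST k. 0 < k \<and>
     vec_span (dim_col B)
       {z \<in> mat_kernel B. \<forall>t<dim_col B. z $ t \<in> \<int> \<and> \<bar>z $ t\<bar> \<le> real k} = mat_kernel B)"


definition psd :: "real mat \<Rightarrow> bool" where
  "psd A \<longleftrightarrow> square_mat A \<and> transpose_mat A = A \<and>
     (\<forall>v\<in>carrier_vec (dim_row A). 0 \<le> v \<bullet> (A *\<^sub>v v))"

definition nonneg_mat :: "real mat \<Rightarrow> bool" where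
  "nonneg_mat A \<longleftrightarrow> (\<forall>i<dim_row A. \<forall>j<dim_col A. 0 \<le> A $$ (i,j))"

definition doubly_nonneg :: "real mat \<Rightarrow> bool" where
  "doubly_nonneg A \<longleftrightarrow> psd A \<and> nonneg_mat A"

definition completely_positive :: "real mat \<Rightarrow> bool" where
  "completely_positive A \<longleftrightarrow> (\<exists>N. nonneg_mat N \<and> A = transpose_mat N * N)"

definition cp_rank :: "real mat \<Rightarrow> nat" where
  "cp_rank A = (LEAST m. \<exists>N. dim_row N = m \<and> nonneg_mat N \<and> A = transpose_mat N * N)"

definition all_ones :: "nat \<Rightarrow> real mat" where
  "all_ones m = mat m m (\<lambda>_. 1)"

definition kronecker :: "real mat \<Rightarrow> real mat \<Rightarrow> real mat" where
  "kronecker A B = mat (dim_row A * dim_row B) (dim_col A * dim_col B)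
     (\<lambda>(i,j). A $$ (i div dim_row B, j div dim_col B) * B $$ (i mod dim_row B, j mod dim_col B))"


text \<open>Undirected graphs are symmetric digraphs, as in \<^verbatim>\<open>Graph_Theory\<close>.\<close>

definition support_graph :: "real mat \<Rightarrow> nat pair_pre_digraph" where
  "support_graph W = \<lparr>pverts = {..<dim_row W},
     parcs = {(i,j). i < dim_row W \<and> j < dim_row W \<and> 0 < W $$ (i,j)}\<rparr>"

definition offdiag_support_graph :: "real mat \<Rightarrow> nat pair_pre_digraph" where
  "offdiag_support_graph Z = \<lparr>pverts = {..<dim_row Z},
     parcs = {(s,t). s < dim_row Z \<and> t < dim_row Z \<and> s \<noteq> t \<and> Z $$ (s,t) \<noteq> 0}\<rparr>"

definition isolated_vertex :: "nat pair_pre_digraph \<Rightarrow> nat \<Rightarrow> bool" where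
  "isolated_vertex G v \<longleftrightarrow>
     v \<in> pverts G \<and> in_arcs (with_proj G) v = {} \<and> out_arcs (with_proj G) v = {}"

text \<open>The qualified name avoids topological connectedness.\<close>

abbreviation connected_graph :: "nat pair_pre_digraph \<Rightarrow> bool" where
  "connected_graph G \<equiv> Digraph_Component.connected (with_proj G)"


definition maxcut_weights :: "real mat \<Rightarrow> bool" where
  "maxcut_weights W \<longleftrightarrow> square_mat W \<and> transpose_mat W = W \<and> nonneg_mat W \<and>
     (\<forall>i<dim_row W. W $$ (i,i) = 0)"

definition sign_vectors :: "nat \<Rightarrow> real vec set" where
  "sign_vectors n = {x \<in> carrier_vec n. \<forall>i<n. x $ i \<in> {-1, 1}}"

text \<open>The sums range over ordered pairs, so every edge is counted twice; hence the factor 1/4.\<close>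

definition cut_value :: "real mat \<Rightarrow> real vec \<Rightarrow> real" where
  "cut_value W x = 1/4 * (\<Sum>i<dim_row W. \<Sum>j\<in>{..<dim_row W} - {i}. W $$ (i,j) * (1 - x $ i * x $ j))"

definition MC :: "real mat \<Rightarrow> real" where
  "MC W = Max (cut_value W ` sign_vectors (dim_row W))"

definition sdp_feasible :: "nat \<Rightarrow> real mat \<Rightarrow> bool" where
  "sdp_feasible n X \<longleftrightarrow> X \<in> carrier_mat n n \<and> psd X \<and> (\<forall>i<n. X $$ (i,i) = 1)"

definition sdp_value :: "real mat \<Rightarrow> real mat \<Rightarrow> real" where
  "sdp_value W X = 1/4 * (\<Sum>i<dim_row W. \<Sum>j\<in>{..<dim_row W} - {i}. W $$ (i,j) * (1 - X $$ (i,j)))"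

definition SDP :: "real mat \<Rightarrow> real" where
  "SDP W = (GREATEST v. \<exists>X. sdp_feasible (dim_row W) X \<and> v = sdp_value W X)"

definition exact :: "real mat \<Rightarrow> bool" where
  "exact W \<longleftrightarrow> MC W = SDP W"

definition optimal_cuts :: "real mat \<Rightarrow> real vec set" where
  "optimal_cuts W = {x \<in> sign_vectors (dim_row W). cut_value W x = MC W}"

definition cut_dim :: "real mat \<Rightarrow> nat" where
  "cut_dim W = vectorspace.dim class_ring
     (subspace_vs (dim_row W) (vec_span (dim_row W) (optimal_cuts W)))"

definition laplacian :: "real mat \<Rightarrow> real mat" where
  "laplacian W = mat_diag (dim_row W) (\<lambda>i. \<Sum>j<dim_row W. W $$ (i,j)) - W"

definition slack :: "real mat \<Rightarrow> real vec \<Rightarrow> real mat" where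
  "slack W s = mat_diag (dim_row W) (\<lambda>i. s $ i) - (1/4) \<cdot>\<^sub>m laplacian W"

definition dual_feasible :: "real mat \<Rightarrow> real vec \<Rightarrow> bool" where
  "dual_feasible W s \<longleftrightarrow> s \<in> carrier_vec (dim_row W) \<and> psd (slack W s)"

definition dual_optimal :: "real mat \<Rightarrow> real vec \<Rightarrow> bool" where
  "dual_optimal W s \<longleftrightarrow> dual_feasible W s \<and>
     (\<forall>t. dual_feasible W t \<longrightarrow> (\<Sum>i<dim_row W. s $ i) \<le> (\<Sum>i<dim_row W. t $ i))"

text \<open>
  Meaningful only if the dual optimum is unique, as it is for exact instances without isolated
  vertices.
\<close>

definition optimal_slack :: "real mat \<Rightarrow> real mat" where
  "optimal_slack W = slack W (THE s. dual_optimal W s)"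

definition dual_rank :: "real mat \<Rightarrow> nat" where
  "dual_rank W = mat_rank (optimal_slack W)"


definition blowup_weights :: "real mat \<Rightarrow> nat \<Rightarrow> real mat" where
  "blowup_weights Z k = mat (2 * k * dim_row Z) (2 * k * dim_row Z)
     (\<lambda>(i,j). if i = j then 0 else 4 * kronecker Z (all_ones (2 * k)) $$ (i,j))"

lemma maxcut_weights_blowup:
  assumes "doubly_nonneg Z"
  shows "maxcut_weights (blowup_weights Z k)"
proof -
  have sq: "dim_col Z = dim_row Z" and tr: "transpose_mat Z = Z" and nn: "nonneg_mat Z"
    using assms by (auto simp: doubly_nonneg_def psd_def)
  have bd: "i div (2 * k) < dim_row Z" if "i < 2 * k * dim_row Z" for i
    using that by (metis less_mult_imp_div_less mult.commute)
  have md: "i mod (2 * k) < 2 * k" if "i < 2 * k * dim_row Z" for i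
    using that by (cases k) auto
  have sym: "Z $$ (a,b) = Z $$ (b,a)" if "a < dim_row Z" "b < dim_row Z" for a b
    using that sq tr by (metis index_transpose_mat(1))
  have ent: "blowup_weights Z k $$ (i,j) =
      (if i = j then 0 else 4 * Z $$ (i div (2 * k), j div (2 * k)))"
    if "i < 2 * k * dim_row Z" "j < 2 * k * dim_row Z" for i j
    using that md[OF that(1)] md[OF that(2)]
    by (simp add: blowup_weights_def kronecker_def all_ones_def sq mult.commute mult.left_commute)
  have dims: "dim_row (blowup_weights Z k) = 2 * k * dim_row Z"
    "dim_col (blowup_weights Z k) = 2 * k * dim_row Z"
    by (simp_all add: blowup_weights_def)
  have "transpose_mat (blowup_weights Z k) = blowup_weights Z k"
    by (rule eq_matI) (auto simp: dims ent sym bd)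
  moreover have "nonneg_mat (blowup_weights Z k)"
    using nn sq by (auto simp: nonneg_mat_def dims ent bd)
  ultimately show ?thesis
    by (simp add: maxcut_weights_def dims ent)
qed

end

theory Submission
  imports Defs
begin

text \<open>
  Put m = 2k and let P be the matrix that adds up each of the r blocks of m consecutive coordinates
  of a vector of length rm. Then Z \<otimes> J = P' Z P, where J is the all-ones matrix of size m and P' is the
  transpose of P. Placing coordinate s at the first position of block s gives an entrywise nonnegative
  right inverse H of P.
  So P is onto and its transpose is one-to-one, which yields the rank and the kernel of Z \<otimes> J: the
  rank is that of Z, and v lies in the kernel exactly if P v lies in the kernel of Z. As P and H are
  nonnegative, N \<mapsto> N P and N \<mapsto> N H translate completely positive factorizations of Z into those of
  Z \<otimes> J and back with the same number of rows (\<open>nonneg_factorization_blowup_iff\<close>).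

  Exactness rests on one duality identity: the objective at X is the dual value minus the inner
  product of the slack with X. A sign vector in the kernel of a positive semidefinite slack therefore
  closes the gap between cut, relaxation and dual simultaneously. It also pins down the dual
  solution, and it identifies the optimal cuts as the sign vectors in the kernel of the slack
  (\<open>sign_certificate\<close>). For the blow-up, s is chosen so that the slack is Z \<otimes> J. Blocks have even
  length, so half of the signs in every block can be +1; all block sums then vanish and the vector is
  in the kernel.

  The optimal cuts are thus the sign vectors x with P x in the kernel of Z, and two kinds of them
  suffice to span the kernel of Z \<otimes> J (\<open>sign_vectors_span_kernel\<close>). Those with zero block
  sums stay optimal when a +1 and a -1 inside a block are exchanged, and the resulting differences
  span the kernel of P. Block sums of sign vectors take every even value between -2k and 2k independently in each block, so P x = 2z
  is solvable for every integral z in the kernel of Z with entries bounded by k; for k at least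
  kappa Z such z span the kernel of Z. The dimension count is then rank-nullity.

  In the support graph every block is a clique because the diagonal of Z is positive, and paths
  between the indices of Z lift to paths between blocks.
\<close>

section \<open>Spans, ranks and kernels\<close>

lemma vec_span_contains:
  assumes "S \<subseteq> carrier_vec n" "v \<in> S"
  shows "v \<in> vec_span n S"
proof -
  interpret vec_space "TYPE(real)" n .
  show ?thesis using assms by (rule span_mem)
qed

lemma vec_span_add:
  assumes "S \<subseteq> carrier_vec n" "v \<in> vec_span n S" "w \<in> vec_span n S"
  shows "v + w \<in> vec_span n S"
proof -
  interpret vec_space "TYPE(real)" n .
  show ?thesis using assms by (rule span_add1)
qed

lemma vec_span_smult:
  assumes "S \<subseteq> carrier_vec n" "v \<in> vec_span n S"
  shows "c \<cdot>\<^sub>v v \<in> vec_span n S"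
proof -
  interpret vec_space "TYPE(real)" n .
  show ?thesis using assms by (rule smult_in_span)
qed

lemma vec_span_zero: "0\<^sub>v n \<in> vec_span n S"
  using vectorspace.span_zero[OF vec_vs] by (simp add: module_vec_simps)

lemma vec_span_minimal:
  assumes N: "N \<subseteq> carrier_vec n" "0\<^sub>v n \<in> N"
    and add: "\<And>v w. v \<in> N \<Longrightarrow> w \<in> N \<Longrightarrow> v + w \<in> N"
    and smult: "\<And>c v. v \<in> N \<Longrightarrow> c \<cdot>\<^sub>v v \<in> N"
    and S: "S \<subseteq> N"
  shows "vec_span n S \<subseteq> N"
proof -
  interpret vec_space "TYPE(real)" n .
  have "submodule class_ring N V"
    by (rule submodule.intro)
       (use N add smult vec_module in \<open>auto simp: module_vec_simps class_ring_simps\<close>)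
  then show ?thesis by (rule span_is_subset[OF S])
qed

lemma vec_span_sum:
  assumes S: "S \<subseteq> carrier_vec n" and "finite I"
    and "\<And>i. i \<in> I \<Longrightarrow> f i \<in> vec_span n S" "\<And>i. i \<in> I \<Longrightarrow> f i \<in> carrier_vec n"
  shows "vec n (\<lambda>j. \<Sum>i\<in>I. f i $ j) \<in> vec_span n S"
  using assms(2-)
proof (induction I rule: finite_induct)
  case empty
  have "vec n (\<lambda>j. \<Sum>i\<in>{}. f i $ j) = 0\<^sub>v n" by auto
  then show ?case using vec_span_zero by metis
next
  case (insert a I)
  have "vec n (\<lambda>j. \<Sum>i\<in>insert a I. f i $ j) = f a + vec n (\<lambda>j. \<Sum>i\<in>I. f i $ j)"
    using insert by (intro eq_vecI) auto
  also have "\<dots> \<in> vec_span n S"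
    using insert by (intro vec_span_add[OF S]) auto
  finally show ?case .
qed

lemma linear_map_mult_mat_vec:
  fixes A :: "real mat"
  assumes A: "A \<in> carrier_mat m n"
  shows "linear_map class_ring (module_vec TYPE(real) n) (module_vec TYPE(real) m) ((*\<^sub>v) A)"
proof -
  have "mod_hom class_ring (module_vec TYPE(real) n) (module_vec TYPE(real) m) ((*\<^sub>v) A)"
    using A
    by (intro mod_hom.intro vec_module mod_hom_axioms.intro)
       (auto simp: LinearCombinations.module_hom_def module_vec_simps class_ring_simps mult_add_distrib_mat_vec
         intro!: mult_mat_vec)
  then show ?thesis
    by (simp add: linear_map_def vec_vs)
qed

lemma mat_rank_eq_dim_image:
  assumes A: "A \<in> carrier_mat m n"
  shows "mat_rank A = vectorspace.dim class_ring (subspace_vs m ((*\<^sub>v) A ` carrier_vec n))"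
proof -
  interpret vec_space "TYPE(real)" m .
  have "span (set (cols A)) = (*\<^sub>v) A ` carrier_vec n"
    using col_space_eq[OF A] A unfolding col_space_def by auto
  then show ?thesis
    using A by (simp add: rank_def)
qed

lemma rank_nullity_mat:
  assumes A: "A \<in> carrier_mat m n"
  shows "mat_rank A + vectorspace.dim class_ring (subspace_vs n (mat_kernel A)) = n"
proof -
  interpret D: vec_space "TYPE(real)" n .
  interpret L: linear_map class_ring "module_vec TYPE(real) n" "module_vec TYPE(real) m" "(*\<^sub>v) A"
    by (rule linear_map_mult_mat_vec[OF A])
  have im: "L.imT = (*\<^sub>v) A ` carrier_vec n"
    by (simp add: L.im_def module_vec_simps)
  have ker: "L.kerT = mat_kernel A"
    using A by (auto simp: L.ker_def mat_kernel_def module_vec_simps)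
  from L.rank_nullity[OF D.fin_dim]
  show ?thesis
    unfolding im ker mat_rank_eq_dim_image[OF A] D.dim_is_n .
qed

text \<open>
  A one-to-one left factor preserves the kernel, so rank-nullity gives equal ranks.
\<close>

lemma mat_rank_mult_left_inverse:
  fixes A L M :: "real mat"
  assumes A: "A \<in> carrier_mat m n" and M: "M \<in> carrier_mat q m" and L: "L \<in> carrier_mat m q"
    and LM: "L * M = 1\<^sub>m m"
  shows "mat_rank (M * A) = mat_rank A"
proof -
  have *: "(M * A) *\<^sub>v v = 0\<^sub>v q \<longleftrightarrow> A *\<^sub>v v = 0\<^sub>v m" if v: "v \<in> carrier_vec n" for v
  proof
    assume "(M * A) *\<^sub>v v = 0\<^sub>v q"
    then have "L *\<^sub>v (M *\<^sub>v (A *\<^sub>v v)) = L *\<^sub>v 0\<^sub>v q"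
      using A M v by simp
    moreover have "L *\<^sub>v (M *\<^sub>v (A *\<^sub>v v)) = (L * M) *\<^sub>v (A *\<^sub>v v)"
      using A M L v by (metis assoc_mult_mat_vec mult_mat_vec_carrier)
    ultimately show "A *\<^sub>v v = 0\<^sub>v m"
      using A L LM v by auto
  next
    assume "A *\<^sub>v v = 0\<^sub>v m"
    then show "(M * A) *\<^sub>v v = 0\<^sub>v q" using A M v by auto
  qed
  have MA: "M * A \<in> carrier_mat q n" using M A by simp
  have "mat_kernel (M * A) = mat_kernel A"
    using * by (auto simp: mat_kernel[OF MA] mat_kernel[OF A])
  then show ?thesis
    using rank_nullity_mat[OF MA] rank_nullity_mat[OF A] by simp
qed

text \<open>
  A right factor that is onto preserves the column space.
\<close>

lemma mat_rank_mult_right_inverse: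
  fixes A M R :: "real mat"
  assumes A: "A \<in> carrier_mat m n" and M: "M \<in> carrier_mat n q" and R: "R \<in> carrier_mat q n"
    and MR: "M * R = 1\<^sub>m n"
  shows "mat_rank (A * M) = mat_rank A"
proof -
  have "(*\<^sub>v) (A * M) ` carrier_vec q = (*\<^sub>v) A ` carrier_vec n" (is "?l = ?r")
  proof
    show "?l \<subseteq> ?r" using A M by auto
    show "?r \<subseteq> ?l"
    proof
      fix y assume "y \<in> ?r"
      then obtain v where v: "v \<in> carrier_vec n" and y: "y = A *\<^sub>v v" by auto
      have "M *\<^sub>v (R *\<^sub>v v) = v"
        using assoc_mult_mat_vec[OF M R v] MR v by simp
      then have "y = (A * M) *\<^sub>v (R *\<^sub>v v)"
        using A M R v y by (metis assoc_mult_mat_vec mult_mat_vec_carrier)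
      then show "y \<in> ?l" using R v by auto
    qed
  qed
  moreover have "A * M \<in> carrier_mat m q" using A M by simp
  ultimately show ?thesis
    by (simp only: mat_rank_eq_dim_image mat_rank_eq_dim_image[OF A])
qed

section \<open>Positive semidefinite matrices\<close>

lemma psd_symmetric:
  assumes "psd A" "i < dim_row A" "j < dim_row A"
  shows "A $$ (i,j) = A $$ (j,i)"
  using assms by (metis psd_def index_transpose_mat(1) square_mat.elims(2))

lemma quadratic_form_sum:
  fixes A :: "real mat"
  assumes "A \<in> carrier_mat n n" "v \<in> carrier_vec n" "w \<in> carrier_vec n"
  shows "v \<bullet> (A *\<^sub>v w) = (\<Sum>i<n. \<Sum>j<n. A $$ (i,j) * (v $ i * w $ j))"
  using assms
  by (auto simp: scalar_prod_def sum_distrib_left atLeast0LessThan algebra_simps intro!: sum.cong)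

text \<open>
  This is Cholesky elimination. The last column divided by the square root of the pivot is split off
  as one square; what remains is the Schur complement, which is the minimum of the form over the last
  coordinate and hence again nonnegative. If the pivot is zero, then its whole column is zero, and the
  same formulas apply because division by zero yields zero.
\<close>

lemma symmetric_nonneg_form_sum_of_squares:
  fixes a :: "nat \<Rightarrow> nat \<Rightarrow> real"
  assumes "\<And>i j. i < n \<Longrightarrow> j < n \<Longrightarrow> a i j = a j i"
    and "\<And>v. 0 \<le> (\<Sum>i<n. \<Sum>j<n. a i j * (v i * v j))"
  shows "\<exists>f. \<forall>i<n. \<forall>j<n. a i j = (\<Sum>p<n. f p i * f p j)"
  using assms
proof (induction n arbitrary: a)
  case 0
  then show ?case by simp
next
  case (Suc n)
  have form: "(\<Sum>i<Suc n. \<Sum>j<Suc n. a i j * (v i * v j)) =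
      (\<Sum>i<n. \<Sum>j<n. a i j * (v i * v j)) + 2 * v n * (\<Sum>i<n. a i n * v i) + a n n * (v n)\<^sup>2" for v
  proof -
    have "(\<Sum>j<n. a n j * (v n * v j)) = v n * (\<Sum>i<n. a i n * v i)"
      unfolding sum_distrib_left using Suc.prems(1) by (intro sum.cong) auto
    moreover have "(\<Sum>i<n. a i n * (v i * v n)) = v n * (\<Sum>i<n. a i n * v i)"
      unfolding sum_distrib_left by (intro sum.cong) auto
    ultimately show ?thesis
      by (simp add: sum.distrib power2_eq_square algebra_simps)
  qed
  have "0 \<le> a n n"
    using Suc.prems(2)[of "\<lambda>i. if i = n then 1 else 0"] unfolding form by simp
  have zero_pivot: "a i n = 0" if "a n n = 0" "i < n" for i
  proof (rule ccontr)
    assume ne: "a i n \<noteq> 0"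
    \<comment> \<open>With a zero pivot the form is affine in the last coordinate and would be unbounded below; the
      chosen c makes its value -1 at the i-th unit vector extended by c.\<close>
    define c where "c = - (a i i + 1) / (2 * a i n)"
    define v where "v j = (if j = n then c else if j = i then 1 else 0)" for j
    have "(\<Sum>k<n. \<Sum>j<n. a k j * (v k * v j)) = (\<Sum>k<n. \<Sum>j<n. if k = i \<and> j = i then a i i else 0)"
      by (intro sum.cong refl) (auto simp: v_def)
    also have "\<dots> = (\<Sum>k<n. if k = i then a i i else 0)"
      using that by (intro sum.cong refl) auto
    also have "\<dots> = a i i" using that by simp
    finally have "(\<Sum>k<n. \<Sum>j<n. a k j * (v k * v j)) = a i i" .
    moreover have "(\<Sum>k<n. a k n * v k) = (\<Sum>k<n. if k = i then a i n else 0)"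
      using that by (intro sum.cong) (auto simp: v_def)
    ultimately have "(\<Sum>k<Suc n. \<Sum>j<Suc n. a k j * (v k * v j)) = a i i + 2 * c * a i n"
      using that unfolding form by (simp add: v_def)
    also have "\<dots> = -1" using ne by (simp add: c_def field_simps)
    finally show False using Suc.prems(2)[of v] by simp
  qed
  define b where "b i j = a i j - a i n * a j n / a n n" for i j
  have "0 \<le> (\<Sum>i<n. \<Sum>j<n. b i j * (v i * v j))" for v
  proof -
    let ?l = "\<Sum>i<n. a i n * v i"
    \<comment> \<open>The last coordinate is chosen to minimise the form of size n + 1; the minimum is the value of
      the Schur complement b at v.\<close>
    define w where "w i = (if i = n then - ?l / a n n else v i)" for i
    have [simp]: "(\<Sum>i<n. a i n * w i) = ?l" "(\<Sum>i<n. \<Sum>j<n. a i j * (w i * w j)) = (\<Sum>i<n. \<Sum>j<n. a i j * (v i * v j))"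
      by (auto simp: w_def intro!: sum.cong)
    have "(\<Sum>i<n. \<Sum>j<n. a i n * a j n / a n n * (v i * v j)) = ?l * ?l / a n n"
      unfolding sum_product sum_divide_distrib by (intro sum.cong refl) (simp add: algebra_simps)
    then have "(\<Sum>i<n. \<Sum>j<n. b i j * (v i * v j)) = (\<Sum>i<n. \<Sum>j<n. a i j * (v i * v j)) - ?l * ?l / a n n"
      by (simp add: b_def left_diff_distrib sum_subtractf)
    also have "\<dots> = (\<Sum>i<Suc n. \<Sum>j<Suc n. a i j * (w i * w j))"
      unfolding form by (cases "a n n = 0") (simp_all add: w_def field_simps power2_eq_square)
    finally show ?thesis using Suc.prems(2)[of w] by simp
  qed
  moreover have "b i j = b j i" if "i < n" "j < n" for i j
    using that Suc.prems(1)[of i j] by (simp add: b_def)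
  ultimately obtain f where f: "\<And>i j. i < n \<Longrightarrow> j < n \<Longrightarrow> b i j = (\<Sum>p<n. f p i * f p j)"
    using Suc.IH[of b] by blast
  define g where "g p i = (if p = n then a i n / sqrt (a n n) else if i = n then 0 else f p i)" for p i
  have "a i j = (\<Sum>p<Suc n. g p i * g p j)" if ij: "i < Suc n" "j < Suc n" for i j
  proof -
    have last: "g n i * g n j = a i n * a j n / a n n"
      using \<open>0 \<le> a n n\<close> by (simp add: g_def)
    show ?thesis
    proof (cases "i = n \<or> j = n")
      case True
      then have "(\<Sum>p<n. g p i * g p j) = 0"
        by (intro sum.neutral) (auto simp: g_def)
      moreover have "a i n * a j n / a n n = a i j"
        using True ij zero_pivot[of i] zero_pivot[of j] Suc.prems(1)[of i j]
        by (cases "a n n = 0") (auto simp: less_Suc_eq)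
      ultimately show ?thesis by (simp add: last)
    next
      case False
      then have "(\<Sum>p<n. g p i * g p j) = b i j"
        using ij f[of i j] by (auto simp: g_def intro!: sum.cong)
      then show ?thesis by (simp add: last b_def)
    qed
  qed
  then show ?case by blast
qed

lemma psd_sum_of_squares:
  assumes "psd A" "A \<in> carrier_mat n n"
  obtains f where "\<And>i j. i < n \<Longrightarrow> j < n \<Longrightarrow> A $$ (i,j) = (\<Sum>p<n. f p i * f p j)"
proof -
  have "0 \<le> (\<Sum>i<n. \<Sum>j<n. A $$ (i,j) * (v i * v j))" for v
  proof -
    have "0 \<le> vec n v \<bullet> (A *\<^sub>v vec n v)"
      using assms unfolding psd_def by auto
    then show ?thesis
      using assms(2) by (simp add: quadratic_form_sum)
  qed
  moreover have "A $$ (i,j) = A $$ (j,i)" if "i < n" "j < n" for i j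
    using assms that by (auto intro: psd_symmetric)
  ultimately show ?thesis
    using symmetric_nonneg_form_sum_of_squares[of n "\<lambda>i j. A $$ (i,j)"] that by blast
qed

text \<open>
  Weak duality: as X is a sum of squares of vectors f (rank-one matrices with entries f i * f j), its inner product with A is a sum of
  values of the quadratic form of A.
\<close>

lemma psd_trace_product_nonneg:
  assumes A: "psd A" "A \<in> carrier_mat n n" and X: "psd X" "X \<in> carrier_mat n n"
  shows "0 \<le> (\<Sum>i<n. \<Sum>j<n. A $$ (i,j) * X $$ (i,j))"
proof -
  obtain f where f: "\<And>i j. i < n \<Longrightarrow> j < n \<Longrightarrow> X $$ (i,j) = (\<Sum>p<n. f p i * f p j)"
    using psd_sum_of_squares[OF X] by blast
  have "(\<Sum>i<n. \<Sum>j<n. A $$ (i,j) * X $$ (i,j)) =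
      (\<Sum>i<n. \<Sum>j<n. \<Sum>p<n. A $$ (i,j) * (f p i * f p j))"
    by (intro sum.cong refl) (simp add: f sum_distrib_left)
  also have "\<dots> = (\<Sum>i<n. \<Sum>p<n. \<Sum>j<n. A $$ (i,j) * (f p i * f p j))"
    by (intro sum.cong refl sum.swap)
  also have "\<dots> = (\<Sum>p<n. \<Sum>i<n. \<Sum>j<n. A $$ (i,j) * (f p i * f p j))"
    by (rule sum.swap)
  also have "\<dots> = (\<Sum>p<n. vec n (f p) \<bullet> (A *\<^sub>v vec n (f p)))"
    using A(2) by (intro sum.cong) (auto simp: quadratic_form_sum)
  also have "\<dots> \<ge> 0"
    using A unfolding psd_def by (intro sum_nonneg) auto
  finally show ?thesis .
qed

text \<open>
  Here A is a sum of squares of linear forms. If the sum vanishes at v, then so does each of the linear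
  forms, and A v is a combination of their values.
\<close>

lemma psd_form_zero_imp_kernel:
  assumes A: "psd A" "A \<in> carrier_mat n n" and v: "v \<in> carrier_vec n" and "v \<bullet> (A *\<^sub>v v) = 0"
  shows "A *\<^sub>v v = 0\<^sub>v n"
proof -
  obtain f where f: "\<And>i j. i < n \<Longrightarrow> j < n \<Longrightarrow> A $$ (i,j) = (\<Sum>p<n. f p i * f p j)"
    using psd_sum_of_squares[OF A] by blast
  let ?l = "\<lambda>p. \<Sum>i<n. f p i * v $ i"
  have row: "(A *\<^sub>v v) $ i = (\<Sum>p<n. f p i * ?l p)" if i: "i < n" for i
  proof -
    have "(A *\<^sub>v v) $ i = (\<Sum>j<n. \<Sum>p<n. f p i * (f p j * v $ j))"
      using A(2) v i by (auto simp: scalar_prod_def atLeast0LessThan f sum_distrib_right mult.assoc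
          intro!: sum.cong)
    also have "\<dots> = (\<Sum>p<n. f p i * ?l p)"
      by (subst sum.swap) (simp add: sum_distrib_left)
    finally show ?thesis .
  qed
  have "v \<bullet> (A *\<^sub>v v) = (\<Sum>i<n. \<Sum>p<n. (f p i * v $ i) * ?l p)"
    using A(2) v by (auto simp: scalar_prod_def atLeast0LessThan row[unfolded scalar_prod_def]
        row sum_distrib_left mult_ac simp del: index_mult_mat_vec intro!: sum.cong)
  also have "\<dots> = (\<Sum>p<n. (?l p)\<^sup>2)"
    by (subst sum.swap) (simp add: power2_eq_square flip: sum_distrib_right)
  finally have "(\<Sum>p<n. (?l p)\<^sup>2) = 0" using assms by simp
  then have "?l p = 0" if "p < n" for p
    using that by (simp add: sum_nonneg_eq_0_iff)
  then have "(A *\<^sub>v v) $ i = 0" if "i < n" for i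
    using that by (simp add: row del: index_mult_mat_vec)
  then show ?thesis using A(2) by (intro eq_vecI) auto
qed

lemma psd_congruence:
  assumes A: "psd A" "A \<in> carrier_mat r r" and P: "P \<in> carrier_mat r n"
  shows "psd (transpose_mat P * (A * P))"
proof -
  have [simp]: "transpose_mat A = A" using A by (simp add: psd_def)
  have carr: "transpose_mat P * (A * P) \<in> carrier_mat n n" using A P by simp
  have "transpose_mat (transpose_mat P * (A * P)) = transpose_mat (A * P) * transpose_mat (transpose_mat P)"
    by (rule transpose_mult[of _ n r _ n]) (use A P in auto)
  also have "transpose_mat (A * P) = transpose_mat P * transpose_mat A"
    by (rule transpose_mult) (use A P in auto)
  finally have "transpose_mat (transpose_mat P * (A * P)) = transpose_mat P * (A * P)"
    using A P by (simp add: assoc_mult_mat[of _ n r _ r _ n])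
  moreover have "0 \<le> v \<bullet> ((transpose_mat P * (A * P)) *\<^sub>v v)" if v: "v \<in> carrier_vec n" for v
  proof -
    have "(transpose_mat P * (A * P)) *\<^sub>v v = transpose_mat P *\<^sub>v (A *\<^sub>v (P *\<^sub>v v))"
      using A P v by (simp add: assoc_mult_mat_vec[of _ n r _ n] assoc_mult_mat_vec[of _ r r _ n])
    moreover have "v \<bullet> (transpose_mat P *\<^sub>v (A *\<^sub>v (P *\<^sub>v v))) = (P *\<^sub>v v) \<bullet> (A *\<^sub>v (P *\<^sub>v v))"
      using A P v transpose_vec_mult_scalar[of P r n v "A *\<^sub>v (P *\<^sub>v v)"]
        comm_scalar_prod[of "A *\<^sub>v (P *\<^sub>v v)" r "P *\<^sub>v v"]
      by (simp add: comm_scalar_prod[of _ n])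
    ultimately show ?thesis
      using A P v by (simp add: psd_def)
  qed
  ultimately show ?thesis
    using carr P by (simp add: psd_def)
qed

section \<open>Optimality certificates for the semidefinite relaxation\<close>

lemma sign_vectors_sq:
  assumes "x \<in> sign_vectors n" "i < n"
  shows "x $ i * x $ i = 1"
  using assms by (auto simp: sign_vectors_def)

lemma finite_sign_vectors: "finite (sign_vectors n)"
proof (rule finite_subset)
  show "sign_vectors n \<subseteq> vec n ` (PiE {..<n} (\<lambda>_. {-1, 1}))"
  proof
    fix x assume "x \<in> sign_vectors n"
    then have "x = vec n (restrict (($) x) {..<n})" "restrict (($) x) {..<n} \<in> PiE {..<n} (\<lambda>_. {-1, 1})"
      by (auto simp: sign_vectors_def)
    then show "x \<in> vec n ` (PiE {..<n} (\<lambda>_. {-1, 1}))" by blast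
  qed
qed (auto intro: finite_PiE)

text \<open>
  The feasible point of the semidefinite relaxation that represents the cut x.
\<close>

definition outer_square :: "real vec \<Rightarrow> real mat" where
  "outer_square x = mat (dim_vec x) (dim_vec x) (\<lambda>(i,j). x $ i * x $ j)"

lemma sdp_feasible_outer_square:
  assumes "x \<in> sign_vectors n"
  shows "sdp_feasible n (outer_square x)"
proof -
  have x: "x \<in> carrier_vec n" using assms by (simp add: sign_vectors_def)
  then have carr: "outer_square x \<in> carrier_mat n n" by (simp add: outer_square_def)
  have "0 \<le> v \<bullet> (outer_square x *\<^sub>v v)" if v: "v \<in> carrier_vec n" for v
  proof -
    have "v \<bullet> (outer_square x *\<^sub>v v) = (\<Sum>i<n. \<Sum>j<n. (x $ i * v $ i) * (x $ j * v $ j))"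
      unfolding quadratic_form_sum[OF carr v v] using x
      by (intro sum.cong refl) (simp add: outer_square_def)
    also have "\<dots> = (\<Sum>i<n. x $ i * v $ i)\<^sup>2"
      by (simp add: power2_eq_square sum_product)
    finally show ?thesis by simp
  qed
  moreover have "transpose_mat (outer_square x) = outer_square x"
    by (rule eq_matI) (auto simp: outer_square_def)
  ultimately show ?thesis
    using carr x assms by (auto simp: sdp_feasible_def psd_def sign_vectors_sq outer_square_def)
qed

lemma cut_value_eq_sdp_value:
  assumes "x \<in> carrier_vec (dim_row W)"
  shows "cut_value W x = sdp_value W (outer_square x)"
  using assms unfolding cut_value_def sdp_value_def
  by (intro arg_cong2[of _ _ _ _ "(*)"] refl sum.cong) (auto simp: outer_square_def)

lemma slack_carrier:
  assumes "maxcut_weights W" "dim_row W = n"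
  shows "slack W s \<in> carrier_mat n n"
  using assms by (auto simp: slack_def laplacian_def maxcut_weights_def)

lemma slack_index:
  assumes "maxcut_weights W" "dim_row W = n" "i < n" "j < n"
  shows "slack W s $$ (i,j) =
    (if i = j then s $ i - (\<Sum>l<n. W $$ (i,l)) / 4 else 0) + W $$ (i,j) / 4"
proof -
  have "dim_col W = n" using assms by (auto simp: maxcut_weights_def)
  then show ?thesis
    using assms by (auto simp: slack_def laplacian_def mat_diag_def diff_divide_distrib)
qed

text \<open>
  On matrices with unit diagonal the inner product with Diag(s) is the sum of s, and the inner product
  with a quarter of the Laplacian is the objective. The gap is therefore the inner product of slack
  and X.
\<close>

lemma sdp_value_duality_gap:
  assumes W: "maxcut_weights W" "dim_row W = n" and X: "\<And>i. i < n \<Longrightarrow> X $$ (i,i) = 1"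
  shows "sdp_value W X = (\<Sum>i<n. s $ i) - (\<Sum>i<n. \<Sum>j<n. slack W s $$ (i,j) * X $$ (i,j))"
proof -
  have "(\<Sum>j<n. slack W s $$ (i,j) * X $$ (i,j)) =
      s $ i - 1/4 * (\<Sum>j\<in>{..<n} - {i}. W $$ (i,j) * (1 - X $$ (i,j)))" if i: "i < n" for i
  proof -
    have ii: "W $$ (i,i) = 0" using W i by (auto simp: maxcut_weights_def)
    have "(\<Sum>j<n. slack W s $$ (i,j) * X $$ (i,j)) = (\<Sum>j<n.
        (if i = j then s $ i - (\<Sum>l<n. W $$ (i,l)) / 4 else 0) + W $$ (i,j) * X $$ (i,j) / 4)"
      using W i X by (intro sum.cong) (auto simp: slack_index algebra_simps)
    also have "\<dots> = s $ i - (\<Sum>l<n. W $$ (i,l)) / 4 + (\<Sum>j<n. W $$ (i,j) * X $$ (i,j)) / 4"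
      using i by (simp add: sum.distrib sum_divide_distrib)
    also have "\<dots> = s $ i - 1/4 * (\<Sum>j<n. W $$ (i,j) * (1 - X $$ (i,j)))"
      by (simp add: algebra_simps sum_subtractf)
    also have "(\<Sum>j<n. W $$ (i,j) * (1 - X $$ (i,j))) = (\<Sum>j\<in>{..<n} - {i}. W $$ (i,j) * (1 - X $$ (i,j)))"
      using i ii by (subst sum.remove[of _ i]) auto
    finally show ?thesis .
  qed
  then show ?thesis
    by (simp add: sdp_value_def W sum_subtractf sum_distrib_left)
qed

lemma cut_value_duality_gap:
  assumes W: "maxcut_weights W" "dim_row W = n" and x: "x \<in> sign_vectors n"
  shows "cut_value W x = (\<Sum>i<n. s $ i) - x \<bullet> (slack W s *\<^sub>v x)"
proof -
  have xc: "x \<in> carrier_vec n" using x by (simp add: sign_vectors_def)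
  have "cut_value W x = (\<Sum>i<n. s $ i) - (\<Sum>i<n. \<Sum>j<n. slack W s $$ (i,j) * outer_square x $$ (i,j))"
    using W x xc by (simp add: cut_value_eq_sdp_value sdp_value_duality_gap[where s = s]
        outer_square_def sign_vectors_sq)
  also have "(\<Sum>i<n. \<Sum>j<n. slack W s $$ (i,j) * outer_square x $$ (i,j)) = x \<bullet> (slack W s *\<^sub>v x)"
    unfolding quadratic_form_sum[OF slack_carrier[OF W] xc xc]
    using xc by (intro sum.cong) (auto simp: outer_square_def)
  finally show ?thesis .
qed

text \<open>
  Complementary slackness with a primal solution of rank one. The gap vanishes at x, so the cut x attains
  the upper bound given by s. A cut y is optimal iff its gap, the value of the slack form at y,
  vanishes, that is iff y is in the kernel. If t is dual optimal as well, then its slack also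
  annihilates x; the two slacks differ by the diagonal matrix of t - s, and no entry of x is zero,
  hence t = s.
\<close>

theorem sign_certificate:
  assumes W: "maxcut_weights W" "dim_row W = n"
    and s: "dual_feasible W s"
    and x: "x \<in> sign_vectors n" "slack W s *\<^sub>v x = 0\<^sub>v n"
  shows "exact W" "optimal_slack W = slack W s"
    "optimal_cuts W = sign_vectors n \<inter> mat_kernel (slack W s)"
proof -
  let ?S = "slack W s" and ?opt = "\<Sum>i<n. s $ i"
  have S: "psd ?S" "?S \<in> carrier_mat n n"
    using s slack_carrier[OF W] by (auto simp: dual_feasible_def)
  have xc: "x \<in> carrier_vec n" using x by (simp add: sign_vectors_def)
  have val_x: "cut_value W x = ?opt"
    using x xc by (simp add: cut_value_duality_gap[OF W x(1), where s = s])
  have upper: "sdp_value W X \<le> ?opt" if "sdp_feasible n X" for X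
    using that psd_trace_product_nonneg[OF S, of X] sdp_value_duality_gap[OF W, of X s]
    by (simp add: sdp_feasible_def)
  have upper_cut: "cut_value W y \<le> ?opt" if y: "y \<in> sign_vectors n" for y
    using upper[OF sdp_feasible_outer_square[OF y]] y W
    by (simp add: cut_value_eq_sdp_value sign_vectors_def)
  have MC: "MC W = ?opt"
    unfolding MC_def using finite_sign_vectors upper_cut x val_x W
    by (intro Max_eqI) (auto simp: image_iff intro!: bexI[of _ x])
  have SDP: "SDP W = ?opt"
    unfolding SDP_def
  proof (rule Greatest_equality)
    show "\<exists>X. sdp_feasible (dim_row W) X \<and> ?opt = sdp_value W X"
      using sdp_feasible_outer_square[OF x(1)] val_x xc W
      by (auto simp: cut_value_eq_sdp_value intro!: exI[of _ "outer_square x"])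
  qed (use upper W in auto)
  show "exact W" by (simp add: exact_def MC SDP)
  show "optimal_cuts W = sign_vectors n \<inter> mat_kernel ?S"
  proof -
    have "cut_value W y = ?opt \<longleftrightarrow> ?S *\<^sub>v y = 0\<^sub>v n" if y: "y \<in> sign_vectors n" for y
      using psd_form_zero_imp_kernel[OF S, of y] y
      by (auto simp: cut_value_duality_gap[OF W y, where s = s] sign_vectors_def)
    then show ?thesis
      using W by (auto simp: optimal_cuts_def MC mat_kernel[OF S(2)] sign_vectors_def)
  qed
  have weak: "?opt \<le> (\<Sum>i<n. t $ i) \<and> ((\<Sum>i<n. t $ i) \<le> ?opt \<longrightarrow> slack W t *\<^sub>v x = 0\<^sub>v n)"
    if t: "dual_feasible W t" for t
  proof -
    have T: "psd (slack W t)" "slack W t \<in> carrier_mat n n"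
      using t slack_carrier[OF W] by (auto simp: dual_feasible_def)
    have "?opt = (\<Sum>i<n. t $ i) - x \<bullet> (slack W t *\<^sub>v x)"
      using cut_value_duality_gap[OF W x(1), where s = t] val_x by simp
    moreover have "0 \<le> x \<bullet> (slack W t *\<^sub>v x)"
      using T xc by (simp add: psd_def)
    ultimately show ?thesis
      using psd_form_zero_imp_kernel[OF T xc] by auto
  qed
  have "dual_optimal W s"
    using s weak W by (auto simp: dual_optimal_def)
  moreover have "t = s" if t: "dual_optimal W t" for t
  proof (rule eq_vecI)
    have "dual_feasible W t" "(\<Sum>i<n. t $ i) \<le> ?opt"
      using t s W by (auto simp: dual_optimal_def)
    then have tx: "slack W t *\<^sub>v x = 0\<^sub>v n" using weak by blast
    show dims: "dim_vec t = dim_vec s"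
      using t s by (auto simp: dual_optimal_def dual_feasible_def)
    fix i assume "i < dim_vec s"
    then have i: "i < n" using s W by (auto simp: dual_feasible_def)
    have row: "(\<Sum>j<n. slack W u $$ (i,j) * x $ j) = 0" if "slack W u *\<^sub>v x = 0\<^sub>v n" for u
    proof -
      have "(slack W u *\<^sub>v x) $ i = 0" using that i by simp
      then show ?thesis
        using slack_carrier[OF W, of u] xc i by (auto simp: scalar_prod_def atLeast0LessThan)
    qed
    have "0 = (\<Sum>j<n. slack W t $$ (i,j) * x $ j) - (\<Sum>j<n. slack W s $$ (i,j) * x $ j)"
      using row[OF tx] row[OF x(2)] by simp
    also have "\<dots> = (\<Sum>j<n. if i = j then (t $ i - s $ i) * x $ i else 0)"
      unfolding sum_subtractf[symmetric]
      using i by (intro sum.cong) (auto simp: slack_index[OF W] algebra_simps)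
    also have "\<dots> = (t $ i - s $ i) * x $ i" using i by simp
    finally show "t $ i = s $ i"
      using sign_vectors_sq[OF x(1) i] by auto
  qed
  ultimately have "(THE s. dual_optimal W s) = s" by (intro the_equality)
  then show "optimal_slack W = ?S" by (simp add: optimal_slack_def)
qed

section \<open>Block sums and blow-ups\<close>

lemma block_div_less: "i div m < r" if "i < r * m" for i m r :: nat
  using that by (simp add: less_mult_imp_div_less)

lemma block_pos: "0 < m" if "i < r * m" for i m r :: nat
  using that by (cases m) auto

text \<open>
  The matrix of the map that adds up each block of m consecutive coordinates; its transpose repeats
  every coordinate m times.
\<close>

definition block_sum_mat :: "nat \<Rightarrow> nat \<Rightarrow> real mat" where
  "block_sum_mat m r = mat r (r * m) (\<lambda>(s,i). if i div m = s then 1 else 0)"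

text \<open>
  The matrix of the map that puts coordinate s at the first position of block s and zero elsewhere.
\<close>

definition block_head_mat :: "nat \<Rightarrow> nat \<Rightarrow> real mat" where
  "block_head_mat m r = mat (r * m) r (\<lambda>(i,s). if i = s * m then 1 else 0)"

lemma block_sum_mat_carrier [simp]: "block_sum_mat m r \<in> carrier_mat r (r * m)"
  by (simp add: block_sum_mat_def)

lemma block_head_mat_carrier [simp]: "block_head_mat m r \<in> carrier_mat (r * m) r"
  by (simp add: block_head_mat_def)

lemma block_sum_head: "block_sum_mat m r * block_head_mat m r = 1\<^sub>m r" if "0 < m"
proof (rule eq_matI)
  fix s t assume "s < dim_row (1\<^sub>m r)" "t < dim_col (1\<^sub>m r)"
  then have st: "s < r" "t < r" by simp_all
  have "(block_sum_mat m r * block_head_mat m r) $$ (s,t) =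
      (\<Sum>i<r * m. (if i div m = s then 1 else 0) * (if i = t * m then 1 else 0))"
    using st by (simp add: block_sum_mat_def block_head_mat_def scalar_prod_def atLeast0LessThan)
  also have "\<dots> = (\<Sum>i<r * m. if i = t * m then (if t = s then 1 else 0) else 0)"
    using that by (intro sum.cong) auto
  also have "\<dots> = (1\<^sub>m r) $$ (s,t)" using st that by simp
  finally show "(block_sum_mat m r * block_head_mat m r) $$ (s,t) = (1\<^sub>m r) $$ (s,t)" .
qed (simp_all add: block_sum_mat_def block_head_mat_def)

lemma kronecker_all_ones_carrier:
  assumes "Z \<in> carrier_mat r r"
  shows "kronecker Z (all_ones m) \<in> carrier_mat (r * m) (r * m)"
  using assms by (auto simp: kronecker_def all_ones_def)

lemma kronecker_all_ones_index:
  assumes "Z \<in> carrier_mat r r" "i < r * m" "j < r * m"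
  shows "kronecker Z (all_ones m) $$ (i,j) = Z $$ (i div m, j div m)"
  using assms block_pos[of i r m] by (auto simp: kronecker_def all_ones_def)

text \<open>
  The all-ones matrix is the product of an all-ones column and an all-ones row, which makes the
  Kronecker product a congruence transform of Z. All properties of the blow-up are derived from it.
\<close>

lemma kronecker_all_ones_congruence:
  assumes Z: "Z \<in> carrier_mat r r"
  shows "kronecker Z (all_ones m) = transpose_mat (block_sum_mat m r) * (Z * block_sum_mat m r)"
    (is "_ = transpose_mat ?P * (Z * ?P)")
proof (rule eq_matI)
  fix i j assume "i < dim_row (transpose_mat ?P * (Z * ?P))" "j < dim_col (transpose_mat ?P * (Z * ?P))"
  then have ij: "i < r * m" "j < r * m" by (simp_all add: block_sum_mat_def)
  note div = block_div_less[OF ij(1)] block_div_less[OF ij(2)]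
  have ZP: "(Z * ?P) $$ (s,j) = Z $$ (s, j div m)" if s: "s < r" for s
  proof -
    have "(Z * ?P) $$ (s,j) = (\<Sum>t<r. Z $$ (s,t) * ?P $$ (t,j))"
      using Z s ij by (simp add: block_sum_mat_def scalar_prod_def atLeast0LessThan)
    also have "\<dots> = (\<Sum>t<r. if j div m = t then Z $$ (s,t) else 0)"
      using ij by (intro sum.cong) (auto simp: block_sum_mat_def)
    finally show ?thesis using div by simp
  qed
  have "(transpose_mat ?P * (Z * ?P)) $$ (i,j) = (\<Sum>s<r. ?P $$ (s,i) * (Z * ?P) $$ (s,j))"
    using Z ij by (auto simp: block_sum_mat_def scalar_prod_def atLeast0LessThan)
  also have "\<dots> = (\<Sum>s<r. if i div m = s then Z $$ (s, j div m) else 0)"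
    using ij by (intro sum.cong) (auto simp: ZP, auto simp: block_sum_mat_def)
  also have "\<dots> = Z $$ (i div m, j div m)" using div by simp
  finally show "kronecker Z (all_ones m) $$ (i,j) = (transpose_mat ?P * (Z * ?P)) $$ (i,j)"
    by (simp add: kronecker_all_ones_index[OF Z ij])
qed (use Z in \<open>auto simp: kronecker_def all_ones_def block_sum_mat_def\<close>)

lemma psd_kronecker_all_ones:
  assumes "psd Z" "Z \<in> carrier_mat r r"
  shows "psd (kronecker Z (all_ones m))"
  using psd_congruence[OF assms block_sum_mat_carrier] by (simp add: kronecker_all_ones_congruence[OF assms(2)])

lemma block_head_transpose_left_inverse:
  assumes "0 < m"
  shows "transpose_mat (block_head_mat m r) * transpose_mat (block_sum_mat m r) = 1\<^sub>m r"
  using transpose_mult[of "block_sum_mat m r" r "r * m" "block_head_mat m r" r] block_sum_head[OF assms]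
  by simp

lemma mat_rank_kronecker_all_ones:
  assumes Z: "Z \<in> carrier_mat r r" and m: "0 < m"
  shows "mat_rank (kronecker Z (all_ones m)) = mat_rank Z"
proof -
  have "mat_rank (transpose_mat (block_sum_mat m r) * (Z * block_sum_mat m r)) = mat_rank (Z * block_sum_mat m r)"
    by (rule mat_rank_mult_left_inverse[where m = r and n = "r * m" and q = "r * m", OF _ _ _ block_head_transpose_left_inverse[OF m]])
       (use Z in auto)
  also have "\<dots> = mat_rank Z"
    by (rule mat_rank_mult_right_inverse[OF Z block_sum_mat_carrier block_head_mat_carrier block_sum_head[OF m]])
  finally show ?thesis by (simp add: kronecker_all_ones_congruence[OF Z])
qed

text \<open>
  The transposed block sum matrix is one-to-one and can be cancelled from the left.
\<close>

lemma mat_kernel_kronecker_all_ones: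
  assumes Z: "Z \<in> carrier_mat r r" and m: "0 < m"
  shows "mat_kernel (kronecker Z (all_ones m)) =
    {v \<in> carrier_vec (r * m). block_sum_mat m r *\<^sub>v v \<in> mat_kernel Z}"
proof -
  let ?P = "block_sum_mat m r" and ?H = "block_head_mat m r"
  have "kronecker Z (all_ones m) *\<^sub>v v = 0\<^sub>v (r * m) \<longleftrightarrow> Z *\<^sub>v (?P *\<^sub>v v) = 0\<^sub>v r"
    if v: "v \<in> carrier_vec (r * m)" for v
  proof -
    have Zv: "Z *\<^sub>v (?P *\<^sub>v v) \<in> carrier_vec r"
      using Z by (intro mult_mat_vec_carrier[OF Z]) (simp add: mult_mat_vec_carrier[OF _ v])
    have eq: "kronecker Z (all_ones m) *\<^sub>v v = transpose_mat ?P *\<^sub>v (Z *\<^sub>v (?P *\<^sub>v v))"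
      using Z v by (simp add: kronecker_all_ones_congruence[OF Z] assoc_mult_mat_vec[of _ "r * m" r _ "r * m"]
          assoc_mult_mat_vec[of _ r r _ "r * m"])
    have "transpose_mat ?H *\<^sub>v (transpose_mat ?P *\<^sub>v (Z *\<^sub>v (?P *\<^sub>v v))) = Z *\<^sub>v (?P *\<^sub>v v)"
      using Zv assoc_mult_mat_vec[of "transpose_mat ?H" r "r * m" "transpose_mat ?P" r "Z *\<^sub>v (?P *\<^sub>v v)"]
      by (simp add: block_head_transpose_left_inverse[OF m])
    moreover have "transpose_mat ?H *\<^sub>v 0\<^sub>v (r * m) = 0\<^sub>v r"
      by (rule eq_vecI) (auto simp: block_head_mat_def)
    moreover have "transpose_mat ?P *\<^sub>v 0\<^sub>v r = 0\<^sub>v (r * m)"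
      by (rule eq_vecI) (auto simp: block_sum_mat_def)
    ultimately show ?thesis unfolding eq by metis
  qed
  then show ?thesis
    using mult_mat_vec_carrier[OF block_sum_mat_carrier[of m r]]
    by (auto simp: mat_kernel[OF Z] mat_kernel[OF kronecker_all_ones_carrier[OF Z]])
qed

lemma block_sum_mult_vec_index:
  assumes v: "v \<in> carrier_vec (r * m)" and s: "s < r"
  shows "(block_sum_mat m r *\<^sub>v v) $ s = (\<Sum>q<m. v $ (s * m + q))"
proof (cases "m = 0")
  case True
  then show ?thesis using v s by (simp add: block_sum_mat_def scalar_prod_def)
next
  case False
  have sub: "s * m + m \<le> r * m" using s by (metis Suc_leI mult_Suc mult_le_mono1 add.commute)
  have "(block_sum_mat m r *\<^sub>v v) $ s = (\<Sum>i<r * m. if i div m = s then v $ i else 0)"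
    using v s by (auto simp: block_sum_mat_def scalar_prod_def atLeast0LessThan intro!: sum.cong)
  also have "\<dots> = (\<Sum>i\<in>{i. i < r * m \<and> i div m = s}. v $ i)"
    by (subst sum.inter_filter[symmetric]) auto
  also have "{i. i < r * m \<and> i div m = s} = (+) (s * m) ` {..<m}"
  proof (intro equalityI subsetI)
    fix i assume "i \<in> {i. i < r * m \<and> i div m = s}"
    then have "i = s * m + i mod m" "i mod m < m"
      using False by (auto simp: mult.commute)
    then show "i \<in> (+) (s * m) ` {..<m}" by blast
  next
    fix i assume "i \<in> (+) (s * m) ` {..<m}"
    then show "i \<in> {i. i < r * m \<and> i div m = s}" using sub by auto
  qed
  also have "(\<Sum>i\<in>\<dots>. v $ i) = (\<Sum>q<m. v $ (s * m + q))"
    by (subst sum.reindex) auto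
  finally show ?thesis .
qed

lemma block_index:
  fixes s q m r :: nat
  assumes "s < r" "q < m"
  shows "s * m + q < r * m" "(s * m + q) div m = s" "(s * m + q) mod m = q"
proof -
  have "s * m + q < Suc s * m" using assms by simp
  also have "\<dots> \<le> r * m" using assms by (intro mult_le_mono1) simp
  finally show "s * m + q < r * m" .
qed (use assms in auto)

section \<open>Balanced sign vectors\<close>

text \<open>
  Block s begins with c s entries +1 and continues with -1, so that c prescribes the block sums.
\<close>

definition step_signs :: "nat \<Rightarrow> nat \<Rightarrow> (nat \<Rightarrow> nat) \<Rightarrow> real vec" where
  "step_signs m r c = vec (r * m) (\<lambda>i. if i mod m < c (i div m) then 1 else -1)"

lemma step_signs_sign_vector: "step_signs m r c \<in> sign_vectors (r * m)"
  by (auto simp: step_signs_def sign_vectors_def)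

lemma sum_step: "(\<Sum>q<m. if q < c then 1 else - 1 :: real) = 2 * real c - real m" if "c \<le> m"
proof -
  have "(\<Sum>q<m. if q < c then 1 else - 1 :: real) = (\<Sum>q<m. 2 * (if q < c then 1 else 0) - 1)"
    by (intro sum.cong) auto
  also have "\<dots> = 2 * real (card {q. q < m \<and> q < c}) - real m"
    by (simp add: sum_subtractf flip: sum_distrib_left sum.inter_filter)
  also have "{q. q < m \<and> q < c} = {..<c}" using that by auto
  finally show ?thesis by simp
qed

lemma block_sum_step_signs:
  assumes "\<And>s. s < r \<Longrightarrow> c s \<le> m"
  shows "block_sum_mat m r *\<^sub>v step_signs m r c = vec r (\<lambda>s. 2 * real (c s) - real m)"
proof (rule eq_vecI)
  fix s assume "s < dim_vec (vec r (\<lambda>s. 2 * real (c s) - real m))"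
  then have s: "s < r" by simp
  have "(block_sum_mat m r *\<^sub>v step_signs m r c) $ s = (\<Sum>q<m. step_signs m r c $ (s * m + q))"
    by (rule block_sum_mult_vec_index[OF _ s]) (simp add: step_signs_def)
  also have "\<dots> = (\<Sum>q<m. if q < c s then 1 else -1)"
    using block_index[OF s] by (intro sum.cong) (auto simp: step_signs_def)
  also have "\<dots> = 2 * real (c s) - real m" using assms s by (intro sum_step) auto
  finally show "(block_sum_mat m r *\<^sub>v step_signs m r c) $ s = vec r (\<lambda>s. 2 * real (c s) - real m) $ s"
    using s by simp
qed (simp add: block_sum_mat_def)

lemma balanced_in_kernel:
  assumes Z: "Z \<in> carrier_mat r r" and "block_sum_mat (2 * k) r *\<^sub>v x = 0\<^sub>v r"
    and "x \<in> carrier_vec (r * (2 * k))" "0 < k"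
  shows "x \<in> mat_kernel (kronecker Z (all_ones (2 * k)))"
proof -
  have "Z *\<^sub>v 0\<^sub>v r = 0\<^sub>v r" using Z by (intro eq_vecI) auto
  then show ?thesis
    using assms by (simp add: mat_kernel_kronecker_all_ones mat_kernel[OF Z])
qed

text \<open>
  Off the diagonal every slack is W / 4, which is the Kronecker product; the vector s is what the
  diagonal entries then require.
\<close>

lemma blowup_dual_solution:
  assumes Z: "Z \<in> carrier_mat r r" "doubly_nonneg Z" and k: "0 < k"
  defines "W \<equiv> blowup_weights Z k"
  shows "slack W (vec (r * (2 * k)) (\<lambda>i. Z $$ (i div (2*k), i div (2*k)) + (\<Sum>l<r * (2*k). W $$ (i,l)) / 4)) =
    kronecker Z (all_ones (2 * k))" (is "slack W ?s = ?K")
proof -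
  have n: "dim_row W = r * (2 * k)" using Z by (simp add: W_def blowup_weights_def)
  have W: "maxcut_weights W" unfolding W_def by (rule maxcut_weights_blowup[OF Z(2)])
  note K = kronecker_all_ones_carrier[OF Z(1), of "2 * k"]
  have "slack W ?s $$ (i,j) = ?K $$ (i,j)" if ij: "i < r * (2 * k)" "j < r * (2 * k)" for i j
  proof -
    have "W $$ (i,j) = (if i = j then 0 else 4 * Z $$ (i div (2*k), j div (2*k)))"
      using ij Z by (auto simp: W_def blowup_weights_def kronecker_all_ones_index mult.commute)
    then show ?thesis
      using ij by (simp add: slack_index[OF W n ij] kronecker_all_ones_index[OF Z(1) ij])
  qed
  then show ?thesis
    using slack_carrier[OF W n] K by (intro eq_matI) auto
qed

text \<open>
  The first half of every block gets +1 and the second half -1. The block sums are zero, so this sign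
  vector lies in the kernel of the slack and serves as certificate.
\<close>

theorem blowup_certificate:
  assumes Z: "Z \<in> carrier_mat r r" "doubly_nonneg Z" and k: "0 < k"
  defines "W \<equiv> blowup_weights Z k" and "K \<equiv> kronecker Z (all_ones (2 * k))"
  shows "exact W" "optimal_slack W = K" "optimal_cuts W = sign_vectors (r * (2 * k)) \<inter> mat_kernel K"
proof -
  have n: "dim_row W = r * (2 * k)" using Z by (simp add: W_def blowup_weights_def)
  have W: "maxcut_weights W" unfolding W_def by (rule maxcut_weights_blowup[OF Z(2)])
  define s where "s = vec (r * (2 * k)) (\<lambda>i. Z $$ (i div (2*k), i div (2*k)) + (\<Sum>l<r * (2*k). W $$ (i,l)) / 4)"
  have slack: "slack W s = K"
    using blowup_dual_solution[OF Z k] by (simp add: s_def W_def K_def)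
  have "psd K" unfolding K_def
    using Z by (intro psd_kronecker_all_ones) (auto simp: doubly_nonneg_def)
  then have feasible: "dual_feasible W s"
    by (simp add: dual_feasible_def slack n) (simp add: s_def)
  define x where "x = step_signs (2 * k) r (\<lambda>_. k)"
  have "block_sum_mat (2 * k) r *\<^sub>v x = 0\<^sub>v r"
    unfolding x_def by (subst block_sum_step_signs) auto
  then have "x \<in> mat_kernel K"
    unfolding K_def using k by (intro balanced_in_kernel[OF Z(1)]) (simp_all add: x_def step_signs_def)
  then have "slack W s *\<^sub>v x = 0\<^sub>v (r * (2 * k))"
    using kronecker_all_ones_carrier[OF Z(1), of "2 * k"] unfolding slack K_def by (auto simp: mat_kernel)
  moreover have "x \<in> sign_vectors (r * (2 * k))"
    unfolding x_def by (rule step_signs_sign_vector)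
  ultimately show "exact W" "optimal_slack W = K" "optimal_cuts W = sign_vectors (r * (2 * k)) \<inter> mat_kernel K"
    using sign_certificate[OF W n feasible] by (simp_all add: slack)
qed

section \<open>The optimal cuts span the kernel\<close>

text \<open>
  Exchanging a +1 with a -1 inside a block turns one balanced sign vector into another, and their
  difference is a multiple of the difference of two unit vectors. In the balanced vector used here the
  first entry of each block is +1 and the entry at offset k is -1, so a position with sign +1 is
  compared with the first one by way of offset k.
\<close>

lemma block_difference_in_span:
  fixes C :: "real vec set"
  assumes k: "0 < k" and C: "C \<subseteq> carrier_vec (r * (2 * k))"
    and balanced: "\<And>x. x \<in> sign_vectors (r * (2 * k)) \<Longrightarrow> block_sum_mat (2 * k) r *\<^sub>v x = 0\<^sub>v r \<Longrightarrow> x \<in> C"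
    and i: "i < r * (2 * k)"
  shows "unit_vec (r * (2 * k)) i - unit_vec (r * (2 * k)) (i div (2 * k) * (2 * k)) \<in> vec_span (r * (2 * k)) C"
proof -
  define n m s where "n = r * (2 * k)" and "m = 2 * k" and "s = i div m"
  let ?e = "unit_vec n :: nat \<Rightarrow> real vec" and ?P = "block_sum_mat m r"
  have m: "0 < m" and nm: "n = r * m" using k by (auto simp: m_def n_def)
  have s: "s < r" using i by (simp add: s_def m_def block_div_less)
  define x where "x = step_signs m r (\<lambda>_. k)"
  have x: "x \<in> sign_vectors n" "x \<in> carrier_vec n"
    unfolding x_def nm by (rule step_signs_sign_vector) (simp add: step_signs_def)
  have Px: "?P *\<^sub>v x = 0\<^sub>v r"
    unfolding x_def by (subst block_sum_step_signs) (auto simp: m_def)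
  have xval: "x $ a = (if a mod m < k then 1 else -1)" if "a < n" for a
    using that by (simp add: x_def step_signs_def nm)
  have Pe: "?P *\<^sub>v ?e a = unit_vec r (a div m)" if "a < n" for a
  proof (rule eq_vecI)
    fix t assume "t < dim_vec (unit_vec r (a div m) :: real vec)"
    then show "(?P *\<^sub>v ?e a) $ t = unit_vec r (a div m) $ t"
      using that by (simp add: nm block_sum_mat_def scalar_prod_right_unit[of _ "r * m"] block_div_less)
  qed (simp add: block_sum_mat_def)
  \<comment> \<open>Swapping a positive and a negative entry of x inside one block keeps all block sums.\<close>
  have swap: "?e a - ?e b \<in> vec_span n C"
    if a: "a < n" "x $ a = 1" and b: "b < n" "x $ b = -1" and ab: "a div m = b div m" for a b
  proof -
    define y where "y = x - 2 \<cdot>\<^sub>v (?e a - ?e b)"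
    have "a \<noteq> b" using a b by auto
    then have "y \<in> sign_vectors n"
      using x a b by (auto simp: y_def sign_vectors_def unit_vec_def)
    moreover have "?P *\<^sub>v y = 0\<^sub>v r"
    proof -
      have Pc: "?P \<in> carrier_mat r n" by (simp add: nm)
      have "?P *\<^sub>v (?e a - ?e b) = 0\<^sub>v r"
        using a b ab by (subst mult_minus_distrib_mat_vec[OF Pc]) (auto simp: Pe)
      then have "?P *\<^sub>v (2 \<cdot>\<^sub>v (?e a - ?e b)) = 0\<^sub>v r"
        by (subst mult_mat_vec[OF Pc]) auto
      then show ?thesis
        unfolding y_def using x Px by (subst mult_minus_distrib_mat_vec[OF Pc]) auto
    qed
    ultimately have "y \<in> C" "x \<in> C"
      using balanced x Px by (auto simp: n_def m_def)
    then have "(1/2) \<cdot>\<^sub>v (x + (-1) \<cdot>\<^sub>v y) \<in> vec_span n C"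
      using C by (intro vec_span_smult vec_span_add vec_span_contains) (auto simp: n_def)
    also have "(1/2) \<cdot>\<^sub>v (x + (-1) \<cdot>\<^sub>v y) = ?e a - ?e b"
      using x by (intro eq_vecI) (auto simp: y_def)
    finally show ?thesis .
  qed
  have idx: "s * m + 0 < n" "(s * m + 0) div m = s" "s * m + k < n" "(s * m + k) div m = s"
    "x $ (s * m + 0) = 1" "x $ (s * m + k) = -1"
    using block_index[OF s, of 0 m] block_index[OF s, of k m] k xval
    by (auto simp: nm m_def)
  have "?e i - ?e (s * m) \<in> vec_span n C"
  proof (cases "i mod m < k")
    case True
    then have xi: "x $ i = 1" using i xval by (simp add: n_def)
    have "(?e i - ?e (s * m + k)) + (-1) \<cdot>\<^sub>v (?e (s * m + 0) - ?e (s * m + k)) \<in> vec_span n C"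
      using C idx xi i by (intro vec_span_add vec_span_smult swap) (auto simp: n_def s_def)
    also have "(?e i - ?e (s * m + k)) + (-1) \<cdot>\<^sub>v (?e (s * m + 0) - ?e (s * m + k)) = ?e i - ?e (s * m)"
      by (intro eq_vecI) auto
    finally show ?thesis .
  next
    case False
    then have xi: "x $ i = -1" using i xval by (simp add: n_def)
    have "(-1) \<cdot>\<^sub>v (?e (s * m + 0) - ?e i) \<in> vec_span n C"
      using C idx xi i by (intro vec_span_smult swap) (auto simp: n_def s_def)
    also have "(-1) \<cdot>\<^sub>v (?e (s * m + 0) - ?e i) = ?e i - ?e (s * m)"
      by (intro eq_vecI) auto
    finally show ?thesis .
  qed
  then show ?thesis by (simp add: n_def m_def s_def)
qed

text \<open>
  Such a v is the sum of v i times the difference of the unit vectors at i and at the first position of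
  its block: the multiples of the latter add up to the block sums and cancel.
\<close>

lemma zero_block_sums_in_span:
  assumes m: "0 < m" and C: "C \<subseteq> carrier_vec (r * m)"
    and diff: "\<And>i. i < r * m \<Longrightarrow> unit_vec (r * m) i - unit_vec (r * m) (i div m * m) \<in> vec_span (r * m) C"
    and v: "v \<in> carrier_vec (r * m)" "block_sum_mat m r *\<^sub>v v = 0\<^sub>v r"
  shows "v \<in> vec_span (r * m) C"
proof -
  let ?n = "r * m" and ?d = "\<lambda>i. unit_vec (r * m) i - unit_vec (r * m) (i div m * m) :: real vec"
  have "vec ?n (\<lambda>j. \<Sum>i<?n. (v $ i \<cdot>\<^sub>v ?d i) $ j) \<in> vec_span ?n C"
    using diff by (intro vec_span_sum[OF C] vec_span_smult[OF C]) auto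
  also have "vec ?n (\<lambda>j. \<Sum>i<?n. (v $ i \<cdot>\<^sub>v ?d i) $ j) = v"
  proof (rule eq_vecI)
    fix j assume "j < dim_vec v"
    then have j: "j < ?n" using v by simp
    have "(\<Sum>i<?n. (v $ i \<cdot>\<^sub>v ?d i) $ j) =
        (\<Sum>i<?n. (if i = j then v $ i else 0) - (if i div m * m = j then v $ i else 0))"
      using j by (intro sum.cong) (auto simp: unit_vec_def)
    also have "\<dots> = v $ j - (\<Sum>i<?n. if i div m * m = j then v $ i else 0)"
      using j by (simp add: sum_subtractf)
    also have "(\<Sum>i<?n. if i div m * m = j then v $ i else 0) = 0"
    proof (cases "j mod m = 0")
      case True
      have "(\<Sum>i<?n. if i div m * m = j then v $ i else 0) = (\<Sum>i<?n. if i div m = j div m then v $ i else 0)"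
        using True m by (intro sum.cong) auto
      also have "\<dots> = (block_sum_mat m r *\<^sub>v v) $ (j div m)"
        using v(1) block_div_less[OF j]
        by (auto simp: block_sum_mat_def scalar_prod_def atLeast0LessThan intro!: sum.cong)
      also have "\<dots> = 0" using v(2) block_div_less[OF j] by simp
      finally show ?thesis .
    next
      case False
      then show ?thesis by (intro sum.neutral) auto
    qed
    finally show "vec ?n (\<lambda>j. \<Sum>i<?n. (v $ i \<cdot>\<^sub>v ?d i) $ j) $ j = v $ j"
      using j by simp
  qed (use v in auto)
  finally show ?thesis .
qed

text \<open>
  Block t receives k + z t entries +1 among its 2k entries; the bound on z t says that this count lies
  between 0 and 2k.
\<close>

lemma integral_block_sums_attained:
  assumes z: "z \<in> carrier_vec r" "\<And>t. t < r \<Longrightarrow> z $ t \<in> \<int> \<and> \<bar>z $ t\<bar> \<le> real k"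
  obtains x where "x \<in> sign_vectors (r * (2 * k))" "block_sum_mat (2 * k) r *\<^sub>v x = 2 \<cdot>\<^sub>v z"
proof
  define c where "c t = nat (int k + \<lfloor>z $ t\<rfloor>)" for t
  have c: "c t \<le> 2 * k" "real (c t) = real k + z $ t" if t: "t < r" for t
  proof -
    obtain w :: int where w: "z $ t = of_int w" using z(2)[OF t] by (auto elim: Ints_cases)
    then have "\<bar>w\<bar> \<le> int k" using z(2)[OF t] by linarith
    then show "c t \<le> 2 * k" "real (c t) = real k + z $ t" using w by (auto simp: c_def)
  qed
  show "step_signs (2 * k) r c \<in> sign_vectors (r * (2 * k))" by (rule step_signs_sign_vector)
  show "block_sum_mat (2 * k) r *\<^sub>v step_signs (2 * k) r c = 2 \<cdot>\<^sub>v z"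
    using c z(1) by (subst block_sum_step_signs) auto
qed

text \<open>
  The kernel of the blow-up consists of the vectors whose block sums lie in the kernel of Z. Integral
  kernel vectors are, up to the factor 2, block sums of optimal cuts, so modulo vectors with zero block
  sums everything is reached; the latter are spanned by balanced cuts.
\<close>

theorem sign_vectors_span_kernel:
  assumes Z: "Z \<in> carrier_mat r r" and k: "0 < k"
    and span: "vec_span r {z \<in> mat_kernel Z. \<forall>t<r. z $ t \<in> \<int> \<and> \<bar>z $ t\<bar> \<le> real k} = mat_kernel Z"
      (is "vec_span r ?z = _")
  defines "K \<equiv> kronecker Z (all_ones (2 * k))"
  shows "vec_span (r * (2 * k)) (sign_vectors (r * (2 * k)) \<inter> mat_kernel K) = mat_kernel K"
proof -
  define m n where "m = 2 * k" and "n = r * m"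
  define C where "C = sign_vectors n \<inter> mat_kernel K"
  let ?P = "block_sum_mat m r"
  have m: "0 < m" using k by (simp add: m_def)
  have Kc: "K \<in> carrier_mat n n"
    unfolding K_def n_def m_def by (rule kronecker_all_ones_carrier[OF Z])
  have kerK: "mat_kernel K = {v \<in> carrier_vec n. ?P *\<^sub>v v \<in> mat_kernel Z}"
    unfolding K_def m_def n_def using k by (intro mat_kernel_kronecker_all_ones[OF Z]) auto
  have kerZ: "mat_kernel Z \<subseteq> carrier_vec r" by (rule mat_kernel_carrier[OF Z])
  have Pc: "?P \<in> carrier_mat r n" by (simp add: n_def)
  have C: "C \<subseteq> carrier_vec n" by (auto simp: C_def sign_vectors_def)
  have kerK_closed: "v + w \<in> mat_kernel K" "c \<cdot>\<^sub>v v \<in> mat_kernel K"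
    if "v \<in> mat_kernel K" "w \<in> mat_kernel K" for v w c
    using that by (auto simp: mat_kernel[OF Kc] mult_add_distrib_mat_vec[OF Kc] mult_mat_vec[OF Kc])
  have zero: "0\<^sub>v n \<in> mat_kernel K" using Kc by (auto simp: mat_kernel[OF Kc])
  have "vec_span n C \<subseteq> mat_kernel K"
    using kerK_closed zero mat_kernel_carrier[OF Kc] by (intro vec_span_minimal) (auto simp: C_def)
  moreover have "mat_kernel K \<subseteq> vec_span n C"
  proof
    fix v assume v: "v \<in> mat_kernel K"
    then have vc: "v \<in> carrier_vec n" and Pv: "?P *\<^sub>v v \<in> mat_kernel Z" by (auto simp: kerK)
    \<comment> \<open>Block sums of vectors in the span of the cuts form a subspace, and it contains the small integral
      vectors of the kernel of Z.\<close>
    let ?N = "(*\<^sub>v) ?P ` (vec_span n C \<inter> carrier_vec n)"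
    have "vec_span r ?z \<subseteq> ?N"
    proof (rule vec_span_minimal)
      show "?N \<subseteq> carrier_vec r" using Pc by auto
      have "?P *\<^sub>v 0\<^sub>v n = 0\<^sub>v r" using Pc by (intro eq_vecI) auto
      then show "0\<^sub>v r \<in> ?N" using vec_span_zero[of n C] by (intro image_eqI[of _ _ "0\<^sub>v n"]) simp_all
      fix a b assume a: "a \<in> ?N"
      then obtain v where v: "v \<in> vec_span n C" "v \<in> carrier_vec n" "a = ?P *\<^sub>v v" by auto
      show "c \<cdot>\<^sub>v a \<in> ?N" for c
        using v vec_span_smult[OF C v(1), of c]
        by (intro image_eqI[of _ _ "c \<cdot>\<^sub>v v"]) (simp_all add: mult_mat_vec[OF Pc])
      assume "b \<in> ?N"
      then obtain w where w: "w \<in> vec_span n C" "w \<in> carrier_vec n" "b = ?P *\<^sub>v w" by auto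
      show "a + b \<in> ?N"
        using v w vec_span_add[OF C v(1) w(1)]
        by (intro image_eqI[of _ _ "v + w"]) (simp_all add: mult_add_distrib_mat_vec[OF Pc])
    next
      show "?z \<subseteq> ?N"
      proof
        fix z assume z: "z \<in> ?z"
        then have zc: "z \<in> carrier_vec r" using kerZ by auto
        obtain x where x: "x \<in> sign_vectors n" "?P *\<^sub>v x = 2 \<cdot>\<^sub>v z"
          using integral_block_sums_attained[of z r k] z zc by (auto simp: n_def m_def)
        then have xc: "x \<in> carrier_vec n" by (simp add: sign_vectors_def)
        have "x \<in> C"
          using x xc z mat_kernel_smult[OF Z] by (auto simp: C_def kerK)
        then have "(1/2) \<cdot>\<^sub>v x \<in> vec_span n C"
          using C by (intro vec_span_smult vec_span_contains)
        moreover have "?P *\<^sub>v ((1/2) \<cdot>\<^sub>v x) = z"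
          using x xc zc by (simp add: mult_mat_vec[OF Pc] smult_smult_assoc)
        ultimately show "z \<in> ?N"
          using xc by (intro image_eqI[of _ _ "(1/2) \<cdot>\<^sub>v x"]) auto
      qed
    qed
    then obtain w where w: "w \<in> vec_span n C" "w \<in> carrier_vec n" "?P *\<^sub>v w = ?P *\<^sub>v v"
      using Pv span by auto
    have Pcarr: "?P *\<^sub>v v \<in> carrier_vec r" using Pv kerZ by auto
    have balanced: "x \<in> C" if "x \<in> sign_vectors n" "?P *\<^sub>v x = 0\<^sub>v r" for x
      using that balanced_in_kernel[OF Z, of k x] k by (auto simp: C_def K_def n_def m_def sign_vectors_def)
    have "v - w \<in> vec_span (r * m) C"
    proof (rule zero_block_sums_in_span[OF m])
      show "C \<subseteq> carrier_vec (r * m)" using C by (simp add: n_def)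
      show "block_sum_mat m r *\<^sub>v (v - w) = 0\<^sub>v r"
        using vc w Pcarr by (simp add: mult_minus_distrib_mat_vec[OF Pc])
      show "v - w \<in> carrier_vec (r * m)" using vc w by (simp add: n_def)
      show "unit_vec (r * m) i - unit_vec (r * m) (i div m * m) \<in> vec_span (r * m) C" if "i < r * m" for i
        using block_difference_in_span[OF k, of C r i] C balanced that by (simp add: m_def n_def)
    qed
    then have "w + (v - w) \<in> vec_span n C"
      using w C by (intro vec_span_add) (simp_all add: n_def)
    also have "w + (v - w) = v" using w vc by (intro eq_vecI) auto
    finally show "v \<in> vec_span n C" .
  qed
  ultimately show ?thesis by (simp add: C_def n_def m_def)
qed

section \<open>The threshold for integral kernel generators\<close>

lemma common_denominator:
  fixes f :: "nat \<Rightarrow> real"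
  assumes "\<And>i. i < n \<Longrightarrow> f i \<in> \<rat>"
  shows "\<exists>D::nat. 0 < D \<and> (\<forall>i<n. real D * f i \<in> \<int>)"
  using assms
proof (induction n)
  case 0
  then show ?case by auto
next
  case (Suc n)
  then obtain D :: nat where D: "0 < D" "\<And>i. i < n \<Longrightarrow> real D * f i \<in> \<int>" by auto
  obtain a b :: int where ab: "b > 0" "f n = of_int a / of_int b"
    using Suc.prems[of n] by (auto elim: Rats_cases')
  let ?E = "D * nat b"
  have "real ?E * f i \<in> \<int>" if "i < Suc n" for i
  proof (cases "i = n")
    case True
    have "real ?E * f n = real_of_int (int D * a)" using ab by simp
    then show ?thesis using True by (metis Ints_of_int)
  next
    case False
    have "real ?E * f i = real_of_int b * (real D * f i)" using ab by simp
    also have "\<dots> \<in> \<int>" using False that by (intro Ints_mult[OF Ints_of_int D(2)]) auto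
    finally show ?thesis .
  qed
  then show ?case using D ab by (intro exI[of _ ?E]) auto
qed

definition small_integral_kernel :: "real mat \<Rightarrow> nat \<Rightarrow> real vec set" where
  "small_integral_kernel B k = {z \<in> mat_kernel B. \<forall>t<dim_col B. z $ t \<in> \<int> \<and> \<bar>z $ t\<bar> \<le> real k}"

lemma small_integral_kernel_span_subset:
  assumes "B \<in> carrier_mat m r"
  shows "vec_span r (small_integral_kernel B k) \<subseteq> mat_kernel B"
  using assms mat_kernel_carrier[OF assms]
  by (intro vec_span_minimal)
     (auto simp: small_integral_kernel_def mat_kernel[OF assms] mult_add_distrib_mat_vec[OF assms]
       mult_mat_vec[OF assms])

text \<open>
  Multiplying each vector of a finite rational basis by a common denominator of its entries gives integral
  generators; any bound on all their entries can serve as k. Hence the minimum defining kappa exists.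
\<close>

lemma rational_kernel_small_integral_generators:
  assumes B: "B \<in> carrier_mat m r" and rat: "rational_subspace r (mat_kernel B)"
  shows "\<exists>k>0. vec_span r (small_integral_kernel B k) = mat_kernel B"
proof -
  interpret kernel m r B using B by unfold_locales
  obtain U where U: "basis U" "\<And>v i. v \<in> U \<Longrightarrow> i < r \<Longrightarrow> v $ i \<in> \<rat>"
    using rat unfolding rational_subspace_def by blast
  have UK: "U \<subseteq> mat_kernel B" and spanU: "span U = mat_kernel B" and li: "lin_indpt U"
    using U(1) by (auto simp: Ker.basis_def)
  have Uc: "U \<subseteq> carrier_vec r" using UK mat_kernel_carrier[OF B] by auto
  have finU: "finite U"
    using NC.li_le_dim(1)[OF NC.fin_dim Uc] li lindep_same[OF UK] by simp
  have "\<exists>D::nat. 0 < D \<and> (\<forall>i<r. real D * v $ i \<in> \<int>)" if "v \<in> U" for v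
    using U(2)[OF that] by (intro common_denominator)
  then obtain D :: "real vec \<Rightarrow> nat" where D: "\<And>v. v \<in> U \<Longrightarrow> 0 < D v"
    "\<And>v i. v \<in> U \<Longrightarrow> i < r \<Longrightarrow> real (D v) * v $ i \<in> \<int>" by metis
  define M where "M = (\<Sum>v\<in>U. \<Sum>i<r. \<bar>real (D v) * v $ i\<bar>)"
  define k where "k = Suc (nat \<lceil>M\<rceil>)"
  have bound: "\<bar>real (D v) * v $ i\<bar> \<le> real k" if "v \<in> U" "i < r" for v i
  proof -
    have "\<bar>real (D v) * v $ i\<bar> \<le> (\<Sum>i<r. \<bar>real (D v) * v $ i\<bar>)"
      using that by (intro member_le_sum) auto
    also have "\<dots> \<le> M"
      unfolding M_def using that finU
      by (intro member_le_sum[where f = "\<lambda>v. \<Sum>i<r. \<bar>real (D v) * v $ i\<bar>"] sum_nonneg) auto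
    also have "M \<le> real k" unfolding k_def by linarith
    finally show ?thesis .
  qed
  let ?S = "small_integral_kernel B k"
  have Sc: "?S \<subseteq> carrier_vec r"
    using mat_kernel_carrier[OF B] by (auto simp: small_integral_kernel_def)
  have "U \<subseteq> vec_span r ?S"
  proof
    fix v assume v: "v \<in> U"
    have "real (D v) \<cdot>\<^sub>v v \<in> ?S"
      using v UK Uc B D(2)[OF v] bound[OF v] mat_kernel_smult[OF B]
      by (auto simp: small_integral_kernel_def)
    then have "(1 / real (D v)) \<cdot>\<^sub>v (real (D v) \<cdot>\<^sub>v v) \<in> vec_span r ?S"
      by (intro vec_span_smult vec_span_contains Sc)
    then show "v \<in> vec_span r ?S" using D(1)[OF v] by (simp add: smult_smult_assoc)
  qed
  then have "NC.span U \<subseteq> vec_span r ?S" using Sc by (intro NC.span_subsetI)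
  then have "mat_kernel B \<subseteq> vec_span r ?S" using span_same[OF UK] spanU by simp
  moreover have "vec_span r ?S \<subseteq> mat_kernel B" by (rule small_integral_kernel_span_subset[OF B])
  ultimately show ?thesis by (intro exI[of _ k]) (auto simp: k_def)
qed

text \<open>
  The admissible kernel vectors only increase with k, so the spanning property persists above the
  minimum.
\<close>

lemma kappa_pos_and_spans:
  assumes B: "B \<in> carrier_mat m r" and rat: "rational_subspace r (mat_kernel B)"
  shows "0 < kappa B" "kappa B \<le> k \<Longrightarrow> vec_span r (small_integral_kernel B k) = mat_kernel B"
proof -
  have dim: "dim_col B = r" using B by simp
  have least: "0 < kappa B \<and> vec_span r (small_integral_kernel B (kappa B)) = mat_kernel B"
    using rational_kernel_small_integral_generators[OF assms]
    unfolding kappa_def small_integral_kernel_def dim by (rule LeastI_ex)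
  then show "0 < kappa B" by blast
  assume "kappa B \<le> k"
  then have "small_integral_kernel B (kappa B) \<subseteq> small_integral_kernel B k"
    by (force simp: small_integral_kernel_def)
  then have "vec_span r (small_integral_kernel B (kappa B)) \<subseteq> vec_span r (small_integral_kernel B k)"
    by (intro LinearCombinations.module.span_is_monotone[OF vec_module])
  then show "vec_span r (small_integral_kernel B k) = mat_kernel B"
    using least small_integral_kernel_span_subset[OF B] by blast
qed

section \<open>Support graphs\<close>

lemma blowup_weights_pos_iff:
  assumes Z: "Z \<in> carrier_mat r r" and ij: "i < r * (2 * k)" "j < r * (2 * k)"
  shows "0 < blowup_weights Z k $$ (i,j) \<longleftrightarrow> i \<noteq> j \<and> 0 < Z $$ (i div (2 * k), j div (2 * k))"
  using assms by (auto simp: blowup_weights_def kronecker_all_ones_index mult.commute)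

text \<open>
  Every block has at least two vertices and is a clique, the diagonal of Z being positive.
\<close>

lemma blowup_no_isolated_vertex:
  assumes Z: "Z \<in> carrier_mat r r" and diag: "\<forall>i<r. 0 < Z $$ (i,i)" and k: "1 \<le> k"
  shows "\<not> isolated_vertex (support_graph (blowup_weights Z k)) v"
proof
  let ?G = "support_graph (blowup_weights Z k)" and ?m = "2 * k"
  have n: "dim_row (blowup_weights Z k) = r * ?m" using Z by (simp add: blowup_weights_def)
  assume iso: "isolated_vertex ?G v"
  then have v: "v < r * ?m" by (simp add: isolated_vertex_def support_graph_def n)
  note s = block_div_less[OF v]
  define q where "q = (if v mod ?m = 0 then 1 else 0 :: nat)"
  have q: "q < ?m" "q \<noteq> v mod ?m" using k by (auto simp: q_def)
  let ?w = "v div ?m * ?m + q"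
  have w: "?w < r * ?m" "?w div ?m = v div ?m" "?w mod ?m = q"
    using block_index[OF s q(1)] by auto
  then have "v \<noteq> ?w" using q(2) by metis
  then have "0 < blowup_weights Z k $$ (v, ?w)"
    using diag s w v by (simp add: blowup_weights_pos_iff[OF Z])
  then have "(v, ?w) \<in> out_arcs (with_proj ?G) v"
    using v w by (simp add: out_arcs_def support_graph_def n)
  then show False using iso by (metis isolated_vertex_def empty_iff)
qed

lemma mk_symmetric_simps:
  "pverts (mk_symmetric (with_proj G)) = pverts G"
  "(u,v) \<in> parcs (mk_symmetric (with_proj G)) \<longleftrightarrow> (u,v) \<in> parcs G \<or> (v,u) \<in> parcs G"
proof -
  show "pverts (mk_symmetric (with_proj G)) = pverts G" by (simp add: mk_symmetric_def)
  have "parcs (mk_symmetric (with_proj G)) = (\<Union>e\<in>parcs G. {(fst e, snd e), (snd e, fst e)})"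
    by (simp add: mk_symmetric_def)
  also have "\<dots> = parcs G \<union> (parcs G)\<inverse>" by force
  finally show "(u,v) \<in> parcs (mk_symmetric (with_proj G)) \<longleftrightarrow> (u,v) \<in> parcs G \<or> (v,u) \<in> parcs G"
    by simp
qed

lemma wf_mk_symmetric:
  assumes "parcs G \<subseteq> pverts G \<times> pverts G"
  shows "wf_digraph (with_proj (mk_symmetric (with_proj G)))"
proof
  fix e assume "e \<in> arcs (with_proj (mk_symmetric (with_proj G)))"
  then have "(fst e, snd e) \<in> parcs G \<or> (snd e, fst e) \<in> parcs G"
    using mk_symmetric_simps(2)[of "fst e" "snd e" G] by simp
  then show "tail (with_proj (mk_symmetric (with_proj G))) e \<in> verts (with_proj (mk_symmetric (with_proj G)))"
    "head (with_proj (mk_symmetric (with_proj G))) e \<in> verts (with_proj (mk_symmetric (with_proj G)))"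
    using assms by (auto simp: mk_symmetric_simps)
qed

text \<open>
  A path between indices of Z lifts to the blow-up one block at a time, because all vertices of
  adjacent blocks are adjacent. Positive diagonal entries connect the vertices of the initial block.
\<close>

lemma blowup_connected:
  assumes Z: "Z \<in> carrier_mat r r" "doubly_nonneg Z" and diag: "\<forall>i<r. 0 < Z $$ (i,i)" and k: "1 \<le> k"
    and conn: "connected_graph (offdiag_support_graph Z)"
  shows "connected_graph (support_graph (blowup_weights Z k))"
proof -
  define m n where "m = 2 * k" and "n = r * m"
  define G H where "G = mk_symmetric (with_proj (offdiag_support_graph Z))"
    and "H = mk_symmetric (with_proj (support_graph (blowup_weights Z k)))"
  have m: "0 < m" using k by (simp add: m_def)
  have dimZ: "dim_row Z = r" using Z by simp
  have dim: "dim_row (blowup_weights Z k) = n" using Z by (simp add: blowup_weights_def n_def m_def)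
  have vG: "pverts G = {..<r}" and vH: "pverts H = {..<n}"
    by (simp_all add: G_def H_def mk_symmetric_simps offdiag_support_graph_def support_graph_def dim dimZ)
  have aG: "s < r \<and> t < r \<and> s \<noteq> t \<and> 0 < Z $$ (s,t)" if "(s,t) \<in> parcs G" for s t
  proof -
    have st: "s < r" "t < r" "s \<noteq> t" "Z $$ (s,t) \<noteq> 0 \<or> Z $$ (t,s) \<noteq> 0"
      using that unfolding G_def mk_symmetric_simps by (auto simp: offdiag_support_graph_def dimZ)
    have "Z $$ (s,t) = Z $$ (t,s)"
      using Z(2) st dimZ by (intro psd_symmetric) (auto simp: doubly_nonneg_def)
    moreover have "0 \<le> Z $$ (s,t)"
      using Z st by (auto simp: doubly_nonneg_def nonneg_mat_def)
    ultimately show ?thesis using st by (auto simp: less_le)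
  qed
  have aH: "(i,j) \<in> parcs H" if "i < n" "j < n" "i \<noteq> j" "0 < Z $$ (i div m, j div m)" for i j
    unfolding H_def mk_symmetric_simps
    using blowup_weights_pos_iff[OF Z(1), of i k j] that
    by (simp add: support_graph_def dim flip: m_def n_def)
  have div: "i div m < r" if "i < n" for i using that by (simp add: n_def block_div_less)
  interpret G: wf_digraph "with_proj G"
    unfolding G_def by (rule wf_mk_symmetric) (auto simp: offdiag_support_graph_def)
  interpret H: wf_digraph "with_proj H"
    unfolding H_def by (rule wf_mk_symmetric) (auto simp: support_graph_def)
  have lift: "reachable (with_proj H) i j"
    if i: "i < n" and st: "reachable (with_proj G) (i div m) t" and j: "j < n" "j div m = t" for i j t
    using st j
  proof (induction t arbitrary: j rule: G.reachable_induct)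
    case base
    show ?case
    proof (cases "i = j")
      case True
      then show ?thesis using i by (simp add: vH)
    next
      case False
      then have "(i,j) \<in> parcs H"
        using aH[OF i base(2)] base(3) div[OF i] diag by simp
      then show ?thesis by (intro H.reachable_adjI) simp
    qed
  next
    case (step t t')
    then have tt: "t < r" "t \<noteq> t'" "0 < Z $$ (t,t')" using aG[of t t'] by auto
    \<comment> \<open>The first vertex of block t is already reached, and it is adjacent to every vertex of block t'.\<close>
    define h where "h = t * m + 0"
    have h: "h < n" "h div m = t"
      using block_index[OF tt(1) m] by (simp_all add: h_def n_def)
    have "reachable (with_proj H) i h" using step.IH h by blast
    moreover have "(h, j) \<in> arcs_ends (with_proj H)"
      using aH[OF h(1) step.prems(1)] h step.prems tt by auto
    ultimately show ?case by (rule H.reachable_adj_trans)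
  qed
  have sc: "strongly_connected (with_proj G)" using conn by (simp add: connected_def G_def)
  then have "0 < r" by (auto simp: strongly_connected_def vG)
  then have "{..<n} \<noteq> {}" using m by (auto simp: n_def lessThan_empty_iff)
  moreover have "reachable (with_proj H) i j" if "i < n" "j < n" for i j
  proof (rule lift[OF that(1) _ that(2) refl])
    show "reachable (with_proj G) (i div m) (j div m)"
      using sc div that unfolding strongly_connected_def by (simp add: vG)
  qed
  ultimately have "strongly_connected (with_proj H)"
    unfolding strongly_connected_def by (simp add: vH)
  then show ?thesis by (simp add: connected_def H_def)
qed

section \<open>Completely positive factorizations\<close>

lemma nonneg_mat_mult:
  assumes "nonneg_mat A" "nonneg_mat B" "dim_col A = dim_row B"
  shows "nonneg_mat (A * B)"
  using assms by (auto simp: nonneg_mat_def scalar_prod_def intro!: sum_nonneg)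

lemma gram_mult:
  fixes N M :: "real mat"
  assumes N: "N \<in> carrier_mat q r" and M: "M \<in> carrier_mat r n"
  shows "transpose_mat (N * M) * (N * M) = transpose_mat M * ((transpose_mat N * N) * M)"
proof -
  have "transpose_mat (N * M) * (N * M) = transpose_mat M * transpose_mat N * (N * M)"
    using transpose_mult[OF N M] by simp
  also have "\<dots> = transpose_mat M * (transpose_mat N * (N * M))"
    using N M by (intro assoc_mult_mat) auto
  also have "transpose_mat N * (N * M) = transpose_mat N * N * M"
    using N M by (intro assoc_mult_mat[symmetric]) auto
  finally show ?thesis .
qed

text \<open>
  Right multiplication by the nonnegative block sum matrix, or by its nonnegative right inverse, keeps the
  number q of rows of a factor. Fixing q serves complete positivity and cp-rank at once.
\<close>

lemma nonneg_factorization_blowup_iff: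
  assumes Z: "Z \<in> carrier_mat r r" and m: "0 < m"
  shows "(\<exists>N. dim_row N = q \<and> nonneg_mat N \<and> kronecker Z (all_ones m) = transpose_mat N * N) \<longleftrightarrow>
    (\<exists>N. dim_row N = q \<and> nonneg_mat N \<and> Z = transpose_mat N * N)" (is "?K \<longleftrightarrow> ?Z")
proof
  let ?P = "block_sum_mat m r" and ?H = "block_head_mat m r"
  have nonneg: "nonneg_mat ?P" "nonneg_mat ?H"
    by (auto simp: nonneg_mat_def block_sum_mat_def block_head_mat_def)
  show ?Z if fac: ?K
  proof -
    obtain N where N: "dim_row N = q" "nonneg_mat N" "kronecker Z (all_ones m) = transpose_mat N * N"
      using fac by blast
    have "dim_col N = dim_col (kronecker Z (all_ones m))" by (simp add: N(3))
    then have Nc: "N \<in> carrier_mat q (r * m)"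
      using N(1) kronecker_all_ones_carrier[OF Z, of m] by auto
    have "transpose_mat (N * ?H) * (N * ?H) = transpose_mat ?H * (transpose_mat ?P * (Z * ?P) * ?H)"
      by (simp add: gram_mult[OF Nc block_head_mat_carrier] flip: N(3))
         (simp add: kronecker_all_ones_congruence[OF Z])
    also have "transpose_mat ?P * (Z * ?P) * ?H = transpose_mat ?P * (Z * ?P * ?H)"
      using Z by (intro assoc_mult_mat[of _ "r * m" r _ "r * m" _ r]) auto
    also have "Z * ?P * ?H = Z * (?P * ?H)"
      using Z by (intro assoc_mult_mat[of _ r r _ "r * m" _ r]) auto
    also have "Z * (?P * ?H) = Z" using Z by (simp add: block_sum_head[OF m])
    also have "transpose_mat ?H * (transpose_mat ?P * Z) = transpose_mat ?H * transpose_mat ?P * Z"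
      using Z by (intro assoc_mult_mat[symmetric, of _ r "r * m" _ r _ r]) auto
    also have "\<dots> = Z" using Z by (simp add: block_head_transpose_left_inverse[OF m])
    finally have "Z = transpose_mat (N * ?H) * (N * ?H)" by simp
    moreover have "nonneg_mat (N * ?H)"
      using N nonneg Nc by (intro nonneg_mat_mult) (auto simp: block_head_mat_def)
    ultimately show ?Z using N(1) by (intro exI[of _ "N * ?H"]) auto
  qed
  show ?K if fac: ?Z
  proof -
    obtain N where N: "dim_row N = q" "nonneg_mat N" "Z = transpose_mat N * N"
      using fac by blast
    have "dim_col N = dim_col Z" by (simp add: N(3))
    then have Nc: "N \<in> carrier_mat q r" using N(1) Z by auto
    have "kronecker Z (all_ones m) = transpose_mat (N * ?P) * (N * ?P)"
      by (simp add: gram_mult[OF Nc block_sum_mat_carrier] flip: N(3))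
         (simp add: kronecker_all_ones_congruence[OF Z])
    moreover have "nonneg_mat (N * ?P)"
      using N nonneg Nc by (intro nonneg_mat_mult) (auto simp: block_sum_mat_def)
    ultimately show ?K using N(1) by (intro exI[of _ "N * ?P"]) auto
  qed
qed

lemma completely_positive_blowup_iff:
  assumes "Z \<in> carrier_mat r r" "0 < m"
  shows "completely_positive (kronecker Z (all_ones m)) \<longleftrightarrow> completely_positive Z"
  using nonneg_factorization_blowup_iff[OF assms] by (simp add: completely_positive_def) blast

lemma cp_rank_blowup:
  assumes "Z \<in> carrier_mat r r" "0 < m"
  shows "cp_rank (kronecker Z (all_ones m)) = cp_rank Z"
  using nonneg_factorization_blowup_iff[OF assms] by (simp add: cp_rank_def)

section \<open>Exact max-cut instances with prescribed dual slack\<close>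

theorem theorem3p12:
  fixes Z :: "real mat" and r d :: nat
  assumes "Z \<in> carrier_mat r r"
    and "doubly_nonneg Z"
    and "\<forall>i<r. 0 < Z $$ (i,i)"
    and "mat_rank Z = d"
    and "rational_subspace r (mat_kernel Z)"
  shows "(\<forall>k\<ge>1.
        (\<forall>v. \<not> isolated_vertex (support_graph (blowup_weights Z k)) v) \<and>
        exact (blowup_weights Z k) \<and>
        optimal_slack (blowup_weights Z k) = kronecker Z (all_ones (2 * k)) \<and>
        dual_rank (blowup_weights Z k) = d) \<and>
     (\<forall>k\<ge>kappa Z.
        int (cut_dim (blowup_weights Z k)) = int (2 * k * r) - int d \<and>
        vec_span (2 * k * r) (optimal_cuts (blowup_weights Z k))
          = mat_kernel (optimal_slack (blowup_weights Z k))) \<and>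
     (\<forall>m. \<forall>B\<in>carrier_mat m r. mat_kernel B = mat_kernel Z \<longrightarrow> kappa B = kappa Z) \<and>
     (connected_graph (offdiag_support_graph Z) \<longrightarrow>
        (\<forall>k\<ge>1. connected_graph (support_graph (blowup_weights Z k)))) \<and>
     (\<forall>k\<ge>1.
        (completely_positive (kronecker Z (all_ones (2 * k))) \<longleftrightarrow> completely_positive Z) \<and>
        (completely_positive Z \<longrightarrow>
          cp_rank (kronecker Z (all_ones (2 * k))) = cp_rank Z))"
proof (intro conjI allI impI ballI)
  fix k :: nat assume k: "1 \<le> k"
  then have k0: "0 < k" "0 < 2 * k" by auto
  note cert = blowup_certificate[OF assms(1,2) k0(1)]
  show "\<not> isolated_vertex (support_graph (blowup_weights Z k)) v" for v
    by (rule blowup_no_isolated_vertex[OF assms(1,3) k])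
  show "exact (blowup_weights Z k)" by (rule cert)
  show "optimal_slack (blowup_weights Z k) = kronecker Z (all_ones (2 * k))" by (rule cert)
  show "dual_rank (blowup_weights Z k) = d"
    using mat_rank_kronecker_all_ones[OF assms(1) k0(2)] assms(4) by (simp add: dual_rank_def cert(2))
  show "connected_graph (support_graph (blowup_weights Z k))"
    if "connected_graph (offdiag_support_graph Z)"
    by (rule blowup_connected[OF assms(1-3) k that])
  show "completely_positive (kronecker Z (all_ones (2 * k))) = completely_positive Z"
    by (rule completely_positive_blowup_iff[OF assms(1) k0(2)])
  show "cp_rank (kronecker Z (all_ones (2 * k))) = cp_rank Z"
    by (rule cp_rank_blowup[OF assms(1) k0(2)])
next
  fix k assume "kappa Z \<le> k"
  note kappa = kappa_pos_and_spans[OF assms(1,5)]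
  have k: "0 < k" "0 < 2 * k" using kappa(1) \<open>kappa Z \<le> k\<close> by auto
  let ?W = "blowup_weights Z k" and ?K = "kronecker Z (all_ones (2 * k))" and ?n = "r * (2 * k)"
  note cert = blowup_certificate[OF assms(1,2) k(1)]
  have Kc: "?K \<in> carrier_mat ?n ?n" by (rule kronecker_all_ones_carrier[OF assms(1)])
  have n: "dim_row ?W = ?n" using assms(1) by (simp add: blowup_weights_def)
  have span: "vec_span ?n (optimal_cuts ?W) = mat_kernel ?K"
    unfolding cert(3) using kappa(2)[OF \<open>kappa Z \<le> k\<close>] assms(1)
    by (intro sign_vectors_span_kernel[OF assms(1) k(1)]) (simp add: small_integral_kernel_def)
  have comm: "2 * k * r = ?n" by simp
  show "vec_span (2 * k * r) (optimal_cuts ?W) = mat_kernel (optimal_slack ?W)"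
    unfolding comm span cert(2) ..
  have "d + cut_dim ?W = ?n"
    using rank_nullity_mat[OF Kc] mat_rank_kronecker_all_ones[OF assms(1) k(2)] assms(4)
    unfolding cut_dim_def n span by simp
  then show "int (cut_dim ?W) = int (2 * k * r) - int d"
    unfolding comm by linarith
next
  fix m B assume "B \<in> carrier_mat m r" "mat_kernel B = mat_kernel Z"
  then show "kappa B = kappa Z" using assms(1) by (simp add: kappa_def)
qed

end
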